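(* The \textsc{MU-VC} problem can be solved in linear time $O(n)$ on trees, where $n$ is the number of vertices of the input tree.
   Context: All graphs are finite, simple, undirected. A vertex cover of a graph $G$ is a set of vertices intersecting every edge; a minimum vertex cover is one of smallest cardinality. For $S\subseteq V(G)$, $G-S$ denotes the subgraph induced by $V(G)\setminus S$. \textsc{Modulator to Unique Minimum Vertex Cover} (\textsc{MU-VC}): given a graph $G=(V,E)$ and an integer $k$, find a set $S \subseteq V$ with $|S| \leq k$ such that $G - S$ has a unique minimum vertex cover (or report that none exists). *)

theory Defs
  imports Complex_Main "HOL-Library.Landau_Symbols"
begin

section \<open>Graphs and vertex covers\<close>

type_synonym 'a graph = "'a set \<times> 'a set set"

definition verts :: "'a graph \<Rightarrow> 'a set" where
  "verts G = fst G"

definition edges :: "'a graph \<Rightarrow> 'a set set" where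
  "edges G = snd G"

definition is_graph :: "'a graph \<Rightarrow> bool" where
  "is_graph G \<longleftrightarrow> finite (verts G) \<and> (\<forall>e\<in>edges G. e \<subseteq> verts G \<and> card e = 2)"

definition delete_verts :: "'a graph \<Rightarrow> 'a set \<Rightarrow> 'a graph" where
  "delete_verts G S = (verts G - S, {e \<in> edges G. e \<subseteq> verts G - S})"

definition vertex_cover :: "'a graph \<Rightarrow> 'a set \<Rightarrow> bool" where
  "vertex_cover G C \<longleftrightarrow> C \<subseteq> verts G \<and> (\<forall>e\<in>edges G. e \<inter> C \<noteq> {})"

definition min_vertex_cover :: "'a graph \<Rightarrow> 'a set \<Rightarrow> bool" where
  "min_vertex_cover G C \<longleftrightarrow>
     vertex_cover G C \<and> (\<forall>C'. vertex_cover G C' \<longrightarrow> card C \<le> card C')"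

definition mu_vc_solution :: "'a graph \<Rightarrow> int \<Rightarrow> 'a set \<Rightarrow> bool" where
  "mu_vc_solution G k S \<longleftrightarrow>
     S \<subseteq> verts G \<and> int (card S) \<le> k \<and> (\<exists>!C. min_vertex_cover (delete_verts G S) C)"

definition connected_graph :: "'a graph \<Rightarrow> bool" where
  "connected_graph G \<longleftrightarrow> verts G \<noteq> {} \<and>
     (\<forall>u\<in>verts G. \<forall>v\<in>verts G. (u, v) \<in> {(x, y). {x, y} \<in> edges G}\<^sup>*)"

definition is_cycle :: "'a graph \<Rightarrow> 'a list \<Rightarrow> bool" where
  "is_cycle G xs \<longleftrightarrow> 3 \<le> length xs \<and> distinct xs \<and>
     (\<forall>i<length xs. {xs ! i, xs ! (Suc i mod length xs)} \<in> edges G)"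

definition is_tree :: "'a graph \<Rightarrow> bool" where
  "is_tree G \<longleftrightarrow> is_graph G \<and> connected_graph G \<and> (\<nexists>xs. is_cycle G xs)"


section \<open>A word RAM with time-annotated semantics\<close>

text \<open>
  A random access machine presented as a structured imperative language. Its memory consists of
  integer registers and of integer arrays that are accessed by computed indices. A program mentions
  finitely many of them, since names are fixed in its text. The only arithmetic operations are
  addition and subtraction. Each operation takes one unit of time, and every intermediate value has
  to be a word, that is, of absolute value less than the bound \<open>W\<close>: an execution that produces a
  larger value or uses a negative array index is stuck.
\<close>

datatype aexp =
    Num int
  | Var string
  | Elem string aexp
  | Add aexp aexp
  | Sub aexp aexp

datatype bexp =
    Less aexp aexp
  | Eq aexp aexp
  | Neg bexp
  | Conj bexp bexp

datatype com =
    Skip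
  | Assign string aexp
  | Store string aexp aexp
  | Seq com com
  | If bexp com com
  | While bexp com

record state =
  reg :: "string \<Rightarrow> int"
  arr :: "string \<Rightarrow> nat \<Rightarrow> int"

fun aval :: "aexp \<Rightarrow> state \<Rightarrow> int" where
  "aval (Num i) s = i"
| "aval (Var x) s = reg s x"
| "aval (Elem a e) s = arr s a (nat (aval e s))"
| "aval (Add e1 e2) s = aval e1 s + aval e2 s"
| "aval (Sub e1 e2) s = aval e1 s - aval e2 s"

fun bval :: "bexp \<Rightarrow> state \<Rightarrow> bool" where
  "bval (Less e1 e2) s \<longleftrightarrow> aval e1 s < aval e2 s"
| "bval (Eq e1 e2) s \<longleftrightarrow> aval e1 s = aval e2 s"
| "bval (Neg b) s \<longleftrightarrow> \<not> bval b s"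
| "bval (Conj b1 b2) s \<longleftrightarrow> bval b1 s \<and> bval b2 s"

text \<open>Evaluation of an expression without overflow and without illegal array access.\<close>

fun asafe :: "int \<Rightarrow> aexp \<Rightarrow> state \<Rightarrow> bool" where
  "asafe W (Num i) s \<longleftrightarrow> \<bar>i\<bar> < W"
| "asafe W (Var x) s \<longleftrightarrow> \<bar>reg s x\<bar> < W"
| "asafe W (Elem a e) s \<longleftrightarrow> asafe W e s \<and> 0 \<le> aval e s \<and> \<bar>aval (Elem a e) s\<bar> < W"
| "asafe W (Add e1 e2) s \<longleftrightarrow> asafe W e1 s \<and> asafe W e2 s \<and> \<bar>aval (Add e1 e2) s\<bar> < W"
| "asafe W (Sub e1 e2) s \<longleftrightarrow> asafe W e1 s \<and> asafe W e2 s \<and> \<bar>aval (Sub e1 e2) s\<bar> < W"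

fun bsafe :: "int \<Rightarrow> bexp \<Rightarrow> state \<Rightarrow> bool" where
  "bsafe W (Less e1 e2) s \<longleftrightarrow> asafe W e1 s \<and> asafe W e2 s"
| "bsafe W (Eq e1 e2) s \<longleftrightarrow> asafe W e1 s \<and> asafe W e2 s"
| "bsafe W (Neg b) s \<longleftrightarrow> bsafe W b s"
| "bsafe W (Conj b1 b2) s \<longleftrightarrow> bsafe W b1 s \<and> bsafe W b2 s"

fun acost :: "aexp \<Rightarrow> nat" where
  "acost (Num i) = 1"
| "acost (Var x) = 1"
| "acost (Elem a e) = 1 + acost e"
| "acost (Add e1 e2) = 1 + acost e1 + acost e2"
| "acost (Sub e1 e2) = 1 + acost e1 + acost e2"

fun bcost :: "bexp \<Rightarrow> nat" where
  "bcost (Less e1 e2) = 1 + acost e1 + acost e2"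
| "bcost (Eq e1 e2) = 1 + acost e1 + acost e2"
| "bcost (Neg b) = 1 + bcost b"
| "bcost (Conj b1 b2) = 1 + bcost b1 + bcost b2"

text \<open>
  \<open>exec W c s t s'\<close>: with word bound \<open>W\<close>, the program \<open>c\<close> started in \<open>s\<close> terminates in \<open>s'\<close> after
  exactly \<open>t\<close> units of time.
\<close>

inductive exec :: "int \<Rightarrow> com \<Rightarrow> state \<Rightarrow> nat \<Rightarrow> state \<Rightarrow> bool" for W :: int where
  Skip: "exec W Skip s 1 s"
| Assign: "asafe W e s \<Longrightarrow>
    exec W (Assign x e) s (1 + acost e) (s\<lparr>reg := (reg s)(x := aval e s)\<rparr>)"
| Store: "asafe W i s \<Longrightarrow> 0 \<le> aval i s \<Longrightarrow> asafe W e s \<Longrightarrow>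
    exec W (Store a i e) s (1 + acost i + acost e)
      (s\<lparr>arr := (arr s)(a := (arr s a)(nat (aval i s) := aval e s))\<rparr>)"
| Seq: "exec W c1 s1 t1 s2 \<Longrightarrow> exec W c2 s2 t2 s3 \<Longrightarrow> exec W (Seq c1 c2) s1 (t1 + t2) s3"
| IfTrue: "bsafe W b s \<Longrightarrow> bval b s \<Longrightarrow> exec W c1 s t s' \<Longrightarrow>
    exec W (If b c1 c2) s (1 + bcost b + t) s'"
| IfFalse: "bsafe W b s \<Longrightarrow> \<not> bval b s \<Longrightarrow> exec W c2 s t s' \<Longrightarrow>
    exec W (If b c1 c2) s (1 + bcost b + t) s'"
| WhileFalse: "bsafe W b s \<Longrightarrow> \<not> bval b s \<Longrightarrow> exec W (While b c) s (1 + bcost b) s"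
| WhileTrue: "bsafe W b s1 \<Longrightarrow> bval b s1 \<Longrightarrow> exec W c s1 t1 s2 \<Longrightarrow>
    exec W (While b c) s2 t2 s3 \<Longrightarrow> exec W (While b c) s1 (1 + bcost b + t1 + t2) s3"

inductive_cases SkipE: "exec W Skip s t s'"
  and AssignE: "exec W (Assign x e) s t s'"
  and StoreE: "exec W (Store a i e) s t s'"
  and SeqE: "exec W (Seq c1 c2) s t s'"
  and IfE: "exec W (If b c1 c2) s t s'"
  and WhileE: "exec W (While b c) s t s'"

text \<open>
  Executions are deterministic, so the existence of a correct execution below is total correctness.
\<close>

lemma exec_deterministic:
  "exec W c s t s' \<Longrightarrow> exec W c s u s'' \<Longrightarrow> u = t \<and> s'' = s'"
proof (induction arbitrary: u s'' rule: exec.induct)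
  case (Skip s)
  then show ?case by (rule SkipE) simp
next
  case (Assign e s x)
  from Assign.prems show ?case by (rule AssignE) simp
next
  case (Store i s e a)
  from Store.prems show ?case by (rule StoreE) simp
next
  case (Seq c1 s1 t1 s2 c2 t2 s3)
  from Seq.prems show ?case by (rule SeqE) (metis Seq.IH)
next
  case (IfTrue b s c1 t s' c2)
  from IfTrue.prems show ?case
    by (rule IfE) (use IfTrue.hyps in \<open>auto dest!: IfTrue.IH\<close>)
next
  case (IfFalse b s c2 t s' c1)
  from IfFalse.prems show ?case
    by (rule IfE) (use IfFalse.hyps in \<open>auto dest!: IfFalse.IH\<close>)
next
  case (WhileFalse b s c)
  from WhileFalse.prems show ?case
    by (rule WhileE) (use WhileFalse.hyps in simp_all)
next
  case (WhileTrue b s1 c t1 s2 t2 s3)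
  from WhileTrue.prems show ?case
    by (rule WhileE) (use WhileTrue.hyps in \<open>auto dest!: WhileTrue.IH\<close>)
qed


section \<open>Solving MU-VC on the machine\<close>

text \<open>
  The input graph has vertices \<open>0, \<dots>, n - 1\<close> and is given by adjacency lists in arbitrary order.
\<close>

definition adjacency_lists :: "nat graph \<Rightarrow> nat list list \<Rightarrow> bool" where
  "adjacency_lists G adj \<longleftrightarrow> verts G = {..<length adj} \<and>
     (\<forall>v<length adj. distinct (adj ! v) \<and> set (adj ! v) = {u. {u, v} \<in> edges G})"

text \<open>
  The concatenated adjacency lists are stored in the array \<open>nbr\<close>; the list of vertex \<open>v\<close> occupies
  the positions from \<open>start[v]\<close> (inclusive) to \<open>start[v+1]\<close> (exclusive). All other memory is 0.
\<close>

definition init_state :: "nat list list \<Rightarrow> int \<Rightarrow> state" where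
  "init_state adj k =
     \<lparr> reg = (\<lambda>_. 0)(''n'' := int (length adj), ''k'' := k),
       arr = (\<lambda>_ _. 0)
         (''start'' := (\<lambda>v. if v \<le> length adj then int (length (concat (take v adj))) else 0),
          ''nbr'' := (\<lambda>i. if i < length (concat adj) then int (concat adj ! i) else 0)) \<rparr>"

text \<open>
  The register \<open>found\<close> of the final state tells whether a solution exists; if so, the array \<open>S\<close>
  holds its characteristic vector.
\<close>

definition correct_output :: "nat graph \<Rightarrow> int \<Rightarrow> state \<Rightarrow> bool" where
  "correct_output G k s \<longleftrightarrow>
     (if reg s ''found'' \<noteq> 0
      then mu_vc_solution G k {v \<in> verts G. arr s ''S'' v \<noteq> 0}
      else \<nexists>S. mu_vc_solution G k S)"

text \<open>
  The word bound \<open>(n + \<bar>k\<bar> + 2) ^ d\<close> says that words have \<open>O(log (n + \<bar>k\<bar>))\<close> bits.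
\<close>

definition solves_mu_vc_on :: "(nat graph \<Rightarrow> bool) \<Rightarrow> com \<Rightarrow> (nat \<Rightarrow> nat) \<Rightarrow> bool" where
  "solves_mu_vc_on P c T \<longleftrightarrow>
     (\<exists>d. \<forall>G adj k. is_graph G \<longrightarrow> P G \<longrightarrow> adjacency_lists G adj \<longrightarrow>
        (\<exists>t s. exec ((int (card (verts G)) + \<bar>k\<bar> + 2) ^ d) c (init_state adj k) t s \<and>
               t \<le> T (card (verts G)) \<and> correct_output G k s))"

end

theory Submission
  imports Defs
begin

text \<open>
  The complement of a unique minimum vertex cover of a forest is an independent set \<open>I\<close> such that
  every other vertex has at least two neighbours in \<open>I\<close>, and conversely: two neighbours are
  necessary since a vertex with at most one could be exchanged, and sufficient since a forest has
  fewer edges than vertices. So MU-VC asks for a labelling of the vertices as deleted, independent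
  or covering with a local constraint at every vertex, and a dynamic program on the rooted tree
  minimizes the number of deleted vertices. Its optimality follows by adding up one
  inequality per vertex, in which the contributions of the children telescope.

  On the machine, a breadth-first search orders the vertices; one pass over the reversed order
  computes the tables, and one pass over the order reads off an optimal labelling.
\<close>

text \<open>The labels below a vertex interact with the rest of the tree only through two bits:
  whether the vertex is independent and whether its parent is. A covering vertex that lacks
  independent neighbours would have to force a child into the independent set against the child's
  own optimum. That costs at least one further deletion, the same as deleting the vertex itself.
  Hence it suffices to count the children that are independent for free. No optimum of a subtree is
  ever defined. The tables are known only through their recursion equations, and both bounds are
  sums over all vertices of one local statement: an inequality for an arbitrary solution, an
  equality for the labelling that is read off. This takes the place of an induction over subtrees.
  Linear time also rests on the edge bound for forests, which limits the adjacency lists to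
  \<open>2 * n\<close> entries; the search inspects each of them at most once.\<close>

abbreviation acyclic_graph :: "'a graph \<Rightarrow> bool" where
  "acyclic_graph G \<equiv> \<nexists>xs. is_cycle G xs"

section \<open>Edges and vertex deletion\<close>

lemma edge_verts:
  assumes "is_graph G" "{u, v} \<in> edges G"
  shows "u \<in> verts G" "v \<in> verts G" "u \<noteq> v"
  using assms unfolding is_graph_def by (force simp: card_2_iff)+

lemma edgeE:
  assumes "is_graph G" "e \<in> edges G"
  obtains u v where "e = {u, v}" "u \<noteq> v" "u \<in> verts G" "v \<in> verts G"
proof -
  have "card e = 2" "e \<subseteq> verts G"
    using assms unfolding is_graph_def by auto
  then show thesis
    using that by (auto simp: card_2_iff)
qed

lemma finite_edges:
  assumes "is_graph G"
  shows "finite (edges G)"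
proof (rule finite_subset)
  show "edges G \<subseteq> Pow (verts G)" "finite (Pow (verts G))"
    using assms unfolding is_graph_def by auto
qed

lemma verts_delete [simp]: "verts (delete_verts G S) = verts G - S"
  by (simp add: delete_verts_def verts_def)

lemma edges_delete: "edges (delete_verts G S) = {e \<in> edges G. e \<subseteq> verts G - S}"
  by (simp add: delete_verts_def edges_def verts_def)

lemma is_graph_delete: "is_graph G \<Longrightarrow> is_graph (delete_verts G S)"
  by (auto simp: is_graph_def edges_delete)

lemma acyclic_delete: "acyclic_graph G \<Longrightarrow> acyclic_graph (delete_verts G S)"
  by (auto simp: is_cycle_def edges_delete)

section \<open>Forests\<close>

definition is_path :: "'a graph \<Rightarrow> 'a list \<Rightarrow> bool" where
  "is_path G xs \<longleftrightarrow> xs \<noteq> [] \<and> distinct xs \<and> set xs \<subseteq> verts G \<and>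
     (\<forall>i. Suc i < length xs \<longrightarrow> {xs ! i, xs ! Suc i} \<in> edges G)"

lemma is_path_Cons:
  assumes "is_path G xs" "w \<in> verts G" "w \<notin> set xs" "{w, hd xs} \<in> edges G"
  shows "is_path G (w # xs)"
  using assms unfolding is_path_def by (auto simp: nth_Cons hd_conv_nth split: nat.splits)

text \<open>The first vertex of a longest path has a second neighbour, which must lie on the path.\<close>

lemma cycle_if_min_degree_2:
  assumes G: "is_graph G" and ne: "verts G \<noteq> {}"
    and deg: "\<And>v. v \<in> verts G \<Longrightarrow> 2 \<le> card {u. {u, v} \<in> edges G}"
  shows "\<exists>xs. is_cycle G xs"
proof -
  have fin: "finite (verts G)"
    using G by (simp add: is_graph_def)
  obtain v0 where "v0 \<in> verts G"
    using ne by auto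
  then have "is_path G [v0]"
    by (simp add: is_path_def)
  moreover have "\<forall>xs. is_path G xs \<longrightarrow> length xs < Suc (card (verts G))"
    using fin by (metis card_mono distinct_card is_path_def less_Suc_eq_le)
  ultimately have "\<exists>xs. is_path G xs \<and> (\<forall>ys. is_path G ys \<longrightarrow> length ys \<le> length xs)"
    by (rule ex_has_greatest_nat)
  then obtain xs where xs: "is_path G xs"
    and longest: "\<And>ys. is_path G ys \<Longrightarrow> length ys \<le> length xs"
    by auto
  have hd: "hd xs = xs ! 0" "hd xs \<in> verts G" and dist: "distinct xs"
    using xs by (auto simp: is_path_def hd_conv_nth)
  define N where "N = {u. {u, hd xs} \<in> edges G}"
  have "2 \<le> card N"
    using deg hd by (simp add: N_def)
  then obtain w where w: "w \<in> N" "length xs \<ge> 2 \<longrightarrow> w \<noteq> xs ! 1"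
    by (metis One_nat_def Suc_1 card.empty card_le_Suc0_iff_eq card.infinite not_less_eq_eq
        zero_le)
  have w_edge: "{w, hd xs} \<in> edges G"
    using w by (simp add: N_def)
  have "w \<in> set xs"
    using longest[OF is_path_Cons[OF xs]] edge_verts[OF G w_edge] w_edge by fastforce
  then obtain i where i: "i < length xs" "xs ! i = w"
    by (auto simp: in_set_conv_nth)
  have "i \<noteq> 0"
    using edge_verts(3)[OF G w_edge] i hd by metis
  moreover have "i \<noteq> 1"
    using w i by auto
  ultimately have i2: "i \<ge> 2"
    by simp
  have len: "length (take (Suc i) xs) = Suc i"
    using i by simp
  \<comment> \<open>The path from \<open>hd xs\<close> to \<open>w\<close>, closed by the edge
    between them; \<open>i2\<close> provides the three vertices that a cycle needs.\<close>
  have "is_cycle G (take (Suc i) xs)"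
    unfolding is_cycle_def
  proof (intro conjI allI impI)
    show "3 \<le> length (take (Suc i) xs)" "distinct (take (Suc i) xs)"
      using i i2 dist by auto
    fix l assume l: "l < length (take (Suc i) xs)"
    show "{take (Suc i) xs ! l, take (Suc i) xs ! (Suc l mod length (take (Suc i) xs))} \<in> edges G"
    proof (cases "l = i")
      case True
      then show ?thesis
        using i w_edge hd unfolding len by simp
    next
      case False
      then show ?thesis
        using l i xs unfolding len by (simp add: is_path_def)
    qed
  qed
  then show ?thesis ..
qed

text \<open>A vertex of degree at most one exists, since minimum degree two forces a cycle. Removing
  it loses at most one edge.\<close>

lemma forest_card_edges:
  assumes "is_graph G" "acyclic_graph G" "verts G \<noteq> {}"
  shows "card (edges G) < card (verts G)"
  using assms
proof (induction "card (verts G)" arbitrary: G rule: less_induct)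
  case less
  note G = less.prems(1)
  have fin: "finite (verts G)"
    using G by (simp add: is_graph_def)
  have "\<exists>v\<in>verts G. \<not> 2 \<le> card {u. {u, v} \<in> edges G}"
    using cycle_if_min_degree_2[OF G less.prems(3)] less.prems(2) by blast
  then obtain v where v: "v \<in> verts G" and "\<not> 2 \<le> card {u. {u, v} \<in> edges G}" ..
  then have deg: "card {u. {u, v} \<in> edges G} \<le> 1"
    by simp
  define H where "H = delete_verts G {v}"
  have card: "Suc (card (verts H)) = card (verts G)"
    using card_Suc_Diff1[OF fin v] by (simp add: H_def)
  have "edges G \<subseteq> edges H \<union> (\<lambda>u. {u, v}) ` {u. {u, v} \<in> edges G}"
  proof
    fix e assume e: "e \<in> edges G"
    then obtain a b where "e = {a, b}" "a \<in> verts G" "b \<in> verts G"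
      using edgeE[OF G] by metis
    then show "e \<in> edges H \<union> (\<lambda>u. {u, v}) ` {u. {u, v} \<in> edges G}"
      using e by (auto simp: H_def edges_delete insert_commute)
  qed
  moreover have finN: "finite {u. {u, v} \<in> edges G}"
    using fin by (rule rev_finite_subset) (auto dest: edge_verts[OF G])
  moreover have finH: "finite (edges H)"
    using is_graph_delete[OF G] unfolding H_def by (rule finite_edges)
  ultimately have "card (edges G) \<le> card (edges H) + card ((\<lambda>u. {u, v}) ` {u. {u, v} \<in> edges G})"
    by (meson card_Un_le card_mono finite_UnI finite_imageI le_trans)
  also have "\<dots> \<le> card (edges H) + 1"
    using le_trans[OF card_image_le[OF finN] deg] by (rule add_left_mono)
  finally have *: "card (edges G) \<le> card (edges H) + 1" .
  show ?case
  proof (cases "verts H = {}")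
    case True
    then have "verts G = {v}"
      using v by (auto simp: H_def)
    then have "edges G = {}"
      using edgeE[OF G] by (metis equals0I singletonD)
    then show ?thesis
      using v fin card_gt_0_iff[of "verts G"] by auto
  next
    case False
    then have "card (edges H) < card (verts H)"
      using less.hyps[of H] card is_graph_delete[OF G, of "{v}"]
        acyclic_delete[OF less.prems(2), of "{v}"] by (simp add: H_def)
    then show ?thesis
      using * card by linarith
  qed
qed

section \<open>Unique minimum vertex covers of forests\<close>

text \<open>Exchange argument: if \<open>v\<close> has at most one neighbour outside
  \<open>C\<close>, replacing \<open>v\<close> by that neighbour gives a cover that is no larger and
  misses \<open>v\<close>, against uniqueness.\<close>

lemma strong_if_unique_min_vertex_cover:
  assumes G: "is_graph G" and C: "min_vertex_cover G C"
    and unique: "\<And>C'. min_vertex_cover G C' \<Longrightarrow> C' = C" and v: "v \<in> C"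
  shows "2 \<le> card {u \<in> verts G - C. {u, v} \<in> edges G}"
proof (rule ccontr)
  define N where "N = {u \<in> verts G - C. {u, v} \<in> edges G}"
  assume "\<not> ?thesis"
  then have N1: "card N \<le> 1"
    by (simp add: N_def)
  have finV: "finite (verts G)"
    using G by (simp add: is_graph_def)
  have CV: "C \<subseteq> verts G" and cov: "\<And>e. e \<in> edges G \<Longrightarrow> e \<inter> C \<noteq> {}"
    using C by (auto simp: min_vertex_cover_def vertex_cover_def)
  then have finC: "finite C" and finN: "finite N"
    using finV finite_subset[of C "verts G"] by (auto simp: N_def)
  define C' where "C' = (C - {v}) \<union> N"
  have "vertex_cover G C'"
    unfolding vertex_cover_def
  proof (intro conjI ballI)
    show "C' \<subseteq> verts G"
      using CV by (auto simp: C'_def N_def)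
    fix e assume e: "e \<in> edges G"
    obtain a b where ab: "e = {a, b}" "a \<in> verts G" "b \<in> verts G" "a \<noteq> b"
      using edgeE[OF G e] by metis
    show "e \<inter> C' \<noteq> {}"
      using ab e cov[OF e] by (auto simp: C'_def N_def insert_commute)
  qed
  moreover have "card C' \<le> card C"
  proof -
    have "card C' \<le> card (C - {v}) + card N"
      unfolding C'_def by (rule card_Un_le)
    also have "\<dots> \<le> card C"
      using N1 card.remove[OF finC v] by simp
    finally show ?thesis .
  qed
  ultimately have "min_vertex_cover G C'"
    using C unfolding min_vertex_cover_def by (meson le_trans)
  then have "C' = C"
    by (rule unique)
  then show False
    using v by (auto simp: C'_def N_def)
qed

text \<open>
  Every vertex of \<open>C - C'\<close> has two neighbours in \<open>C' - C\<close>, and the forest induced by both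
  sets has fewer edges than vertices.
\<close>

lemma strong_vertex_cover_smallest:
  assumes G: "is_graph G" and acyc: "acyclic_graph G" and C: "vertex_cover G C"
    and strong: "\<And>v. v \<in> C \<Longrightarrow> 2 \<le> card {u \<in> verts G - C. {u, v} \<in> edges G}"
    and C': "vertex_cover G C'" and "C' \<noteq> C"
  shows "card C < card C'"
proof -
  have finV: "finite (verts G)"
    using G by (simp add: is_graph_def)
  have CV: "C \<subseteq> verts G" "C' \<subseteq> verts G"
    using C C' by (auto simp: vertex_cover_def)
  then have fin: "finite C" "finite C'"
    using finV finite_subset by blast+
  define A B where "A = C - C'" and "B = C' - C"
  define H where "H = delete_verts G (- (A \<union> B))"
  have finAB: "finite A" "finite B"
    using fin by (auto simp: A_def B_def)
  have vH: "verts H = A \<union> B"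
    using CV by (auto simp: H_def A_def B_def)
  have H: "is_graph H" "acyclic_graph H"
    unfolding H_def by (rule is_graph_delete[OF G], rule acyclic_delete[OF acyc])
  define N where "N v = {u \<in> B. {u, v} \<in> edges G}" for v
  have N2: "2 \<le> card (N v)" if v: "v \<in> A" for v
  proof -
    \<comment> \<open>Since \<open>C'\<close> misses \<open>v\<close>, it must cover every edge at
      \<open>v\<close> by the other end.\<close>
    have "{u \<in> verts G - C. {u, v} \<in> edges G} \<subseteq> N v"
      using C' v by (fastforce simp: N_def A_def B_def vertex_cover_def)
    then have "card {u \<in> verts G - C. {u, v} \<in> edges G} \<le> card (N v)"
      using finAB by (intro card_mono) (auto simp: N_def)
    then show ?thesis
      using strong[of v] v by (simp add: A_def)
  qed
  \<comment> \<open>The edges between \<open>A\<close> and \<open>B\<close> are counted from the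
    side of \<open>A\<close>; since \<open>H\<close> is a nonempty forest, they are fewer than its
    vertices.\<close>
  have "2 * card A = (\<Sum>v\<in>A. 2)"
    by simp
  also have "\<dots> \<le> (\<Sum>v\<in>A. card (N v))"
    by (intro sum_mono N2)
  also have "\<dots> = card (SIGMA v:A. N v)"
    using finAB by (intro card_SigmaI[symmetric]) (auto simp: N_def)
  also have "\<dots> \<le> card (edges H)"
  proof (rule card_inj_on_le)
    show "inj_on (\<lambda>(v, u). {u, v}) (SIGMA v:A. N v)"
      by (auto simp: inj_on_def N_def A_def B_def doubleton_eq_iff)
    show "(\<lambda>(v, u). {u, v}) ` (SIGMA v:A. N v) \<subseteq> edges H"
      using CV by (auto simp: H_def edges_delete N_def A_def B_def)
    show "finite (edges H)"
      by (rule finite_edges[OF H(1)])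
  qed
  also have "\<dots> < card (A \<union> B)"
    using forest_card_edges[OF H] vH \<open>C' \<noteq> C\<close> by (auto simp: A_def B_def)
  also have "\<dots> = card A + card B"
    using finAB by (intro card_Un_disjoint) (auto simp: A_def B_def)
  finally have "card A < card B"
    by simp
  moreover have "card C = card A + card (C \<inter> C')"
    using fin by (simp add: A_def card_Diff_subset_Int card_mono)
  moreover have "card C' = card B + card (C \<inter> C')"
    using fin by (simp add: B_def card_Diff_subset_Int card_mono Int_commute)
  ultimately show ?thesis
    by simp
qed

text \<open>Adjacency is taken in \<open>G\<close>, which agrees with the graph without
  \<open>S\<close> on the vertices outside \<open>S\<close>. The constraint can thus be read off the
  original tree.\<close>

definition strong_independent :: "'a graph \<Rightarrow> 'a set \<Rightarrow> 'a set \<Rightarrow> bool" where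
  "strong_independent G S I \<longleftrightarrow> I \<subseteq> verts G - S \<and> (\<forall>u\<in>I. \<forall>v\<in>I. {u, v} \<notin> edges G) \<and>
     (\<forall>v\<in>verts G - S - I. 2 \<le> card {u \<in> I. {u, v} \<in> edges G})"

lemma unique_min_vertex_cover_iff_strong_independent:
  assumes G: "is_graph G" and acyc: "acyclic_graph G"
  shows "(\<exists>!C. min_vertex_cover (delete_verts G S) C) \<longleftrightarrow> (\<exists>I. strong_independent G S I)"
    (is "?L \<longleftrightarrow> ?R")
proof
  define H where "H = delete_verts G S"
  have H: "is_graph H" "acyclic_graph H"
    unfolding H_def by (rule is_graph_delete[OF G], rule acyclic_delete[OF acyc])
  have vH: "verts H = verts G - S"
    and eH: "\<And>u v. u \<in> verts H \<Longrightarrow> v \<in> verts H \<Longrightarrow> {u, v} \<in> edges H \<longleftrightarrow> {u, v} \<in> edges G"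
    by (auto simp: H_def edges_delete)
  show ?R if ?L
  proof -
    obtain C where C: "min_vertex_cover H C" and unique: "\<And>C'. min_vertex_cover H C' \<Longrightarrow> C' = C"
      using \<open>?L\<close> unfolding H_def by auto
    have CV: "C \<subseteq> verts H" and cov: "\<And>e. e \<in> edges H \<Longrightarrow> e \<inter> C \<noteq> {}"
      using C by (auto simp: min_vertex_cover_def vertex_cover_def)
    have "2 \<le> card {u \<in> verts H - C. {u, v} \<in> edges G}" if v: "v \<in> C" for v
    proof -
      have "{u \<in> verts H - C. {u, v} \<in> edges H} = {u \<in> verts H - C. {u, v} \<in> edges G}"
        using eH v CV by auto
      then show ?thesis
        using strong_if_unique_min_vertex_cover[OF H(1) C unique v] by simp
    qed
    moreover have "{u, v} \<notin> edges G" if "u \<in> verts H - C" "v \<in> verts H - C" for u v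
      using that eH[of u v] cov[of "{u, v}"] by auto
    ultimately have "strong_independent G S (verts H - C)"
      unfolding strong_independent_def vH[symmetric] by blast
    then show ?R ..
  qed
  show ?L if ?R
  proof -
    obtain I where I: "strong_independent G S I"
      using \<open>?R\<close> ..
    define C where "C = verts H - I"
    have IC: "verts H - C = I"
      using I by (auto simp: C_def vH strong_independent_def)
    have C: "vertex_cover H C"
      unfolding vertex_cover_def
    proof (intro conjI ballI)
      fix e assume e: "e \<in> edges H"
      obtain a b where ab: "e = {a, b}" "a \<in> verts H" "b \<in> verts H"
        using edgeE[OF H(1) e] by metis
      then have "a \<notin> I \<or> b \<notin> I"
        using I e eH by (auto simp: strong_independent_def)
      then show "e \<inter> C \<noteq> {}"
        using ab by (auto simp: C_def)
    qed (simp add: C_def)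
    have strong: "2 \<le> card {u \<in> verts H - C. {u, v} \<in> edges H}" if v: "v \<in> C" for v
    proof -
      have "{u \<in> verts H - C. {u, v} \<in> edges H} = {u \<in> I. {u, v} \<in> edges G}"
        using eH v I by (auto simp: IC) (auto simp: C_def vH strong_independent_def)
      then show ?thesis
        using I v by (auto simp: strong_independent_def C_def vH)
    qed
    have smallest: "card C < card C'" if "vertex_cover H C'" "C' \<noteq> C" for C'
      using strong_vertex_cover_smallest[OF H C strong that] .
    then have "min_vertex_cover H C"
      using C unfolding min_vertex_cover_def by (metis less_imp_le order_refl)
    moreover have "C' = C" if "min_vertex_cover H C'" for C'
      using smallest that C unfolding min_vertex_cover_def by (metis not_less)
    ultimately show ?L
      unfolding H_def by blast
  qed
qed

section \<open>The dynamic program on a rooted tree\<close>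

text \<open>
  Relative to the optimum of the subtree of a vertex, \<open>flag\<close> says that this optimum is attained
  with the vertex itself in the independent set, and \<open>delta\<close> is the extra number of deletions if
  the parent is in the independent set. Both are functions of the number \<open>t\<close> of flagged children
  and of the sum \<open>d\<close> of the deltas of the children. The optimum of the subtree exceeds the sum of
  the optima at the children by \<open>gain\<close>, which may be negative.
\<close>

definition cap :: "int \<Rightarrow> int" where
  "cap t = (if t < 2 then 1 else 0)"

text \<open>The options while the parent is not independent: an independent vertex costs
  \<open>d\<close>, because every child then pays its delta; a deleted one costs 1; a covering one
  costs nothing given two flagged children. With fewer, covering is no better than deleting, so
  \<open>cap t\<close> is the cheaper of the last two.\<close>

definition gain :: "int \<Rightarrow> int \<Rightarrow> int" where
  "gain t d = min (cap t) d"

definition flag :: "int \<Rightarrow> int \<Rightarrow> bool" where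
  "flag t d \<longleftrightarrow> d \<le> cap t"

text \<open>An independent parent leaves only deletion and covering, and it already supplies one
  neighbour, so a single flagged child is enough. The value is -1 if \<open>t = 1\<close> and
  \<open>gain t d = 1\<close>: the parent then saves a deletion.\<close>

definition delta :: "int \<Rightarrow> int \<Rightarrow> int" where
  "delta t d = (if t = 0 then 1 else 0) - gain t d"

lemma gain_le_1: "gain t d \<le> 1"
  by (auto simp: gain_def cap_def)

lemma gain_le: "gain t d \<le> d"
  by (simp add: gain_def)

lemma excess_if_not_flag: "\<not> flag t d \<Longrightarrow> 1 \<le> d - gain t d"
  by (auto simp: gain_def flag_def)

lemma excess_if_flag: "flag t d \<Longrightarrow> d - gain t d = 0"
  by (auto simp: gain_def flag_def)

section \<open>Lower bound on the number of deletions\<close>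

lemma card_le_1_plus:
  assumes "A \<subseteq> insert x B" "finite B"
  shows "card A \<le> 1 + card B"
proof -
  have "card A \<le> card (insert x B)"
    using assms by (intro card_mono) auto
  also have "\<dots> \<le> 1 + card B"
    by (metis Suc_eq_plus1_left assms(2) card_insert_if le_SucI order_refl)
  finally show ?thesis .
qed

text \<open>The tables enter only through their equations, independently of how a machine fills
  them. At a root, \<open>p v\<close> lies outside \<open>verts G\<close>. The condition
  \<open>no_2_cycle\<close> keeps a parent from being a child as well.\<close>

locale rooted_dp =
  fixes G :: "'a graph" and p :: "'a \<Rightarrow> 'a" and t d :: "'a \<Rightarrow> int"
  assumes graph: "is_graph G" and acyc: "acyclic_graph G"
    and edge_iff: "\<And>u v. u \<in> verts G \<Longrightarrow> v \<in> verts G \<Longrightarrow>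
      {u, v} \<in> edges G \<longleftrightarrow> p u = v \<or> p v = u"
    and no_2_cycle: "\<And>v. v \<in> verts G \<Longrightarrow> p v \<in> verts G \<Longrightarrow> p (p v) \<noteq> v"
    and t_eq: "\<And>v. v \<in> verts G \<Longrightarrow>
      t v = int (card {c \<in> verts G. p c = v \<and> flag (t c) (d c)})"
    and d_eq: "\<And>v. v \<in> verts G \<Longrightarrow> d v = (\<Sum>c | c \<in> verts G \<and> p c = v. delta (t c) (d c))"
begin

lemma finite_verts: "finite (verts G)"
  using graph by (simp add: is_graph_def)

abbreviation children :: "'a \<Rightarrow> 'a set" where
  "children v \<equiv> {c \<in> verts G. p c = v}"

text \<open>
  \<open>excess I v\<close> bounds from below by how much the number of deleted vertices in the subtree of
  \<open>v\<close> exceeds the sum of the gains there.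
\<close>

definition excess :: "'a set \<Rightarrow> 'a \<Rightarrow> int" where
  "excess I v = (if p v \<in> I then delta (t v) (d v)
     else if v \<in> I then d v - gain (t v) (d v) else 0)"

lemma sum_children:
  "(\<Sum>v\<in>verts G. \<Sum>c\<in>children v. f c) = (\<Sum>c | c \<in> verts G \<and> p c \<in> verts G. (f c :: int))"
proof -
  have "(\<Sum>v\<in>verts G. \<Sum>c\<in>children v. f c) =
      (\<Sum>v\<in>verts G. \<Sum>c | c \<in> {c \<in> verts G. p c \<in> verts G} \<and> p c = v. f c)"
    by (intro sum.cong) auto
  also have "\<dots> = (\<Sum>c | c \<in> verts G \<and> p c \<in> verts G. f c)"
    using finite_verts by (intro sum.group) auto
  finally show ?thesis .
qed

text \<open>The telescoping: each vertex is counted once, below its parent. Only vertices whose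
  parent is no vertex are left over; such a parent is not in \<open>I\<close>, so their excess is
  not negative.\<close>

lemma sum_excess_children:
  assumes "I \<subseteq> verts G"
  shows "(\<Sum>v\<in>verts G. \<Sum>c\<in>children v. excess I c) \<le> (\<Sum>v\<in>verts G. excess I v)"
  unfolding sum_children
proof (rule sum_mono2)
  show "0 \<le> excess I b" if "b \<in> verts G - {c \<in> verts G. p c \<in> verts G}" for b
    using that assms gain_le[of "t b" "d b"] by (auto simp: excess_def)
qed (use finite_verts in auto)

lemma excess_nonneg: "v \<notin> I \<Longrightarrow> c \<in> children v \<Longrightarrow> 0 \<le> excess I c"
  using gain_le[of "t c" "d c"] by (auto simp: excess_def)

text \<open>Some child in \<open>I\<close> must be unflagged and pays at least 1. Negative excess
  occurs only below a vertex of \<open>I\<close>, so no other child cancels it.\<close>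

lemma one_le_sum_excess:
  assumes v: "v \<notin> I" and few: "t v < int (card {c \<in> children v. c \<in> I})" and vV: "v \<in> verts G"
  shows "1 \<le> (\<Sum>c\<in>children v. excess I c)"
proof -
  have "\<not> {c \<in> children v. c \<in> I} \<subseteq> {c \<in> verts G. p c = v \<and> flag (t c) (d c)}"
  proof
    assume "{c \<in> children v. c \<in> I} \<subseteq> {c \<in> verts G. p c = v \<and> flag (t c) (d c)}"
    then have "card {c \<in> children v. c \<in> I} \<le> card {c \<in> verts G. p c = v \<and> flag (t c) (d c)}"
      using finite_verts by (intro card_mono) auto
    then show False
      using few t_eq[OF vV] by simp
  qed
  then obtain c where c: "c \<in> children v" "c \<in> I" "\<not> flag (t c) (d c)"
    by auto
  then have "1 \<le> excess I c"
    using v excess_if_not_flag[of "t c" "d c"] by (auto simp: excess_def)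
  also have "\<dots> \<le> (\<Sum>c\<in>children v. excess I c)"
    using c finite_verts excess_nonneg[OF v] by (intro member_le_sum) auto
  finally show ?thesis .
qed

text \<open>If \<open>v\<close> is independent, its children pay exactly \<open>d v\<close> and
  equality holds. If it is deleted, the left side is at most 1. If it is covering, at most one of
  its two neighbours in \<open>I\<close> is the parent; when the flagged children cannot provide the
  others, \<open>one_le_sum_excess\<close> yields the missing unit.\<close>

lemma local_lower_bound:
  assumes I: "strong_independent G S I" and v: "v \<in> verts G"
  shows "gain (t v) (d v) + excess I v \<le>
    (if v \<in> S then 1 else 0) + (\<Sum>c\<in>children v. excess I c)"
proof -
  have IV: "I \<subseteq> verts G" "I \<inter> S = {}" and indep: "\<And>u v. u \<in> I \<Longrightarrow> v \<in> I \<Longrightarrow> {u, v} \<notin> edges G"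
    using I by (auto simp: strong_independent_def)
  show ?thesis
  proof (cases "v \<in> I")
    case True
    have "p v \<notin> I"
      using indep[OF True, of "p v"] edge_iff[OF v, of "p v"] IV by auto
    moreover have "(\<Sum>c\<in>children v. excess I c) = d v"
      unfolding d_eq[OF v] using True by (intro sum.cong) (auto simp: excess_def)
    ultimately show ?thesis
      using True IV by (auto simp: excess_def)
  next
    case vI: False
    define X where "X = {c \<in> children v. c \<in> I}"
    have sum0: "0 \<le> (\<Sum>c\<in>children v. excess I c)"
      by (intro sum_nonneg excess_nonneg[OF vI])
    have finX: "finite X"
      using finite_verts by (simp add: X_def)
    show ?thesis
    proof (cases "v \<in> S")
      case True
      then show ?thesis
        using sum0 vI gain_le_1[of "t v" "d v"] by (auto simp: excess_def delta_def)
    next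
      case False
      define Y where "Y = {u \<in> I. {u, v} \<in> edges G}"
      have Y2: "2 \<le> card Y"
        using I v vI False by (auto simp: strong_independent_def Y_def)
      have Ysub: "u \<in> X \<or> u = p v" if "u \<in> Y" for u
        using that edge_iff[of u v] v IV by (auto simp: Y_def X_def)
      show ?thesis
      proof (cases "p v \<in> I")
        case True
        have "2 \<le> 1 + card X"
          using Y2 card_le_1_plus[OF _ finX, of Y "p v"] Ysub le_trans by blast
        then have "t v = 0 \<Longrightarrow> 1 \<le> (\<Sum>c\<in>children v. excess I c)"
          using one_le_sum_excess[OF vI _ v] by (simp add: X_def)
        then show ?thesis
          using True False sum0 by (auto simp: excess_def delta_def)
      next
        case False
        then have "Y \<subseteq> X"
          using Ysub by (auto simp: Y_def)
        then have "2 \<le> card X"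
          using Y2 card_mono[OF finX, of Y] by linarith
        then have "t v < 2 \<Longrightarrow> 1 \<le> (\<Sum>c\<in>children v. excess I c)"
          using one_le_sum_excess[OF vI _ v] by (simp add: X_def)
        then show ?thesis
          using False \<open>v \<notin> S\<close> sum0 vI by (auto simp: excess_def gain_def cap_def)
      qed
    qed
  qed
qed

lemma sum_indicator:
  "S \<subseteq> verts G \<Longrightarrow> (\<Sum>v\<in>verts G. if v \<in> S then 1 else 0) = int (card S)"
  using finite_verts by (simp add: sum.If_cases Int_absorb1)

lemma sum_gain_le_card:
  assumes "strong_independent G S I" "S \<subseteq> verts G"
  shows "(\<Sum>v\<in>verts G. gain (t v) (d v)) \<le> int (card S)"
proof -
  have "(\<Sum>v\<in>verts G. gain (t v) (d v) + excess I v) \<le>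
      (\<Sum>v\<in>verts G. (if v \<in> S then 1 else 0) + (\<Sum>c\<in>children v. excess I c))"
    using local_lower_bound[OF assms(1)] by (intro sum_mono)
  moreover have "I \<subseteq> verts G"
    using assms by (auto simp: strong_independent_def)
  ultimately show ?thesis
    using sum_excess_children[of I] assms(2) by (simp add: sum.distrib sum_indicator)
qed

end

text \<open>Greedy labelling from the root downwards: a flagged vertex joins \<open>I\<close>
  whenever its parent is not there, which costs nothing and helps the parent. Any other vertex is
  deleted exactly when its flagged children and its parent supply fewer than two neighbours in
  \<open>I\<close>.\<close>

locale rooted_dp_solution = rooted_dp +
  fixes I S :: "'a set"
  assumes I_sub: "I \<subseteq> verts G" and S_sub: "S \<subseteq> verts G"
    and I_iff: "\<And>v. v \<in> verts G \<Longrightarrow> v \<in> I \<longleftrightarrow> p v \<notin> I \<and> flag (t v) (d v)"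
    and S_iff: "\<And>v. v \<in> verts G \<Longrightarrow>
      v \<in> S \<longleftrightarrow> (if p v \<in> I then t v = 0 else \<not> flag (t v) (d v) \<and> t v < 2)"
begin

lemma flagged_child_in_I:
  "v \<notin> I \<Longrightarrow> c \<in> verts G \<Longrightarrow> p c = v \<Longrightarrow> flag (t c) (d c) \<Longrightarrow> c \<in> I"
  using I_iff by blast

lemma strong_independent: "strong_independent G S I"
  unfolding strong_independent_def
proof (intro conjI ballI)
  show "I \<subseteq> verts G - S"
    using I_sub I_iff S_iff by auto
  show "{u, v} \<notin> edges G" if "u \<in> I" "v \<in> I" for u v
    using that I_sub I_iff edge_iff by blast
  fix v assume "v \<in> verts G - S - I"
  then have v: "v \<in> verts G" "v \<notin> S" "v \<notin> I"
    by auto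
  define X where "X = {c \<in> verts G. p c = v \<and> flag (t c) (d c)}"
  define Y where "Y = {u \<in> I. {u, v} \<in> edges G}"
  have finX: "finite X" and finY: "finite Y"
    using finite_verts finite_subset[OF I_sub] by (auto simp: X_def Y_def)
  have t: "t v = int (card X)"
    using t_eq[OF v(1)] by (simp add: X_def)
  have XY: "X \<subseteq> Y"
    using flagged_child_in_I[OF v(3)] edge_iff v(1) by (auto simp: X_def Y_def)
  show "2 \<le> card {u \<in> I. {u, v} \<in> edges G}"
    unfolding Y_def[symmetric]
  proof (cases "p v \<in> I")
    case True
    then have "p v \<in> verts G"
      using I_sub by auto
    \<comment> \<open>The parent is a neighbour in \<open>I\<close> in addition to the flagged
      children, so one of those is enough.\<close>
    then have "p v \<notin> X" "p v \<in> Y"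
      using no_2_cycle[OF v(1)] True edge_iff v(1) by (auto simp: X_def Y_def)
    then have "card X < card Y"
      using XY finY by (intro psubset_card_mono) auto
    moreover have "card X \<noteq> 0"
      using True S_iff v t by auto
    ultimately show "2 \<le> card Y"
      by linarith
  next
    case False
    then have "2 \<le> card X"
      using S_iff I_iff v t by auto
    then show "2 \<le> card Y"
      using card_mono[OF finY XY] by linarith
  qed
qed

text \<open>The inequality of \<open>local_lower_bound\<close> is tight here: below a vertex outside
  \<open>I\<close>, every child in \<open>I\<close> is flagged and has excess 0, and
  \<open>v\<close> is deleted exactly when the right side is 1.\<close>

lemma local_equation:
  assumes v: "v \<in> verts G"
  shows "(if v \<in> S then 1 else 0) + (\<Sum>c\<in>children v. excess I c) =
    gain (t v) (d v) + excess I v"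
proof (cases "v \<in> I")
  case True
  have "(\<Sum>c\<in>children v. excess I c) = d v"
    unfolding d_eq[OF v] using True by (intro sum.cong) (auto simp: excess_def)
  then show ?thesis
    using True I_iff[OF v] S_iff[OF v] by (auto simp: excess_def)
next
  case False
  have "(\<Sum>c\<in>children v. excess I c) = 0"
    using False I_iff excess_if_flag by (intro sum.neutral) (auto simp: excess_def)
  then show ?thesis
    using False I_iff[OF v] S_iff[OF v]
    by (auto simp: excess_def delta_def flag_def gain_def cap_def)
qed

lemma card_S: "int (card S) = (\<Sum>v\<in>verts G. gain (t v) (d v))"
proof -
  have root: "excess I v = 0" if "v \<in> verts G" "p v \<notin> verts G" for v
    using that I_sub I_iff excess_if_flag by (auto simp: excess_def)
  have "(\<Sum>v\<in>verts G. \<Sum>c\<in>children v. excess I c) = (\<Sum>v\<in>verts G. excess I v)"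
    unfolding sum_children using finite_verts root by (intro sum.mono_neutral_left) auto
  moreover have "(\<Sum>v\<in>verts G. (if v \<in> S then 1 else 0) + (\<Sum>c\<in>children v. excess I c)) =
      (\<Sum>v\<in>verts G. gain (t v) (d v) + excess I v)"
    using local_equation by (intro sum.cong) auto
  ultimately show ?thesis
    by (simp add: sum.distrib sum_indicator[OF S_sub])
qed

lemma mu_vc_solution_S: "mu_vc_solution G k S \<longleftrightarrow> int (card S) \<le> k"
proof -
  have "\<exists>!C. min_vertex_cover (delete_verts G S) C"
    unfolding unique_min_vertex_cover_iff_strong_independent[OF graph acyc]
    using strong_independent ..
  then show ?thesis
    using S_sub by (simp add: mu_vc_solution_def)
qed

text \<open>Every solution has at least as many vertices as the sum of the gains, and
  \<open>S\<close> attains this sum.\<close>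

lemma card_S_le:
  assumes "mu_vc_solution G k S'"
  shows "int (card S) \<le> k"
proof -
  note S' = assms[unfolded mu_vc_solution_def]
  have "\<exists>I. strong_independent G S' I"
    using S' unique_min_vertex_cover_iff_strong_independent[OF graph acyc, of S'] by satx
  then obtain I' where "strong_independent G S' I'" ..
  then show ?thesis
    using sum_gain_le_card[of S' I'] S'[THEN conjunct1] S'[THEN conjunct2, THEN conjunct1] card_S
    by linarith
qed

end

section \<open>Total correctness with time bounds\<close>

text \<open>
  Loops have their own rule below, hence the junk time \<open>0\<close> and the precondition \<open>False\<close>.
\<close>

fun max_time :: "com \<Rightarrow> nat" where
  "max_time Skip = 1"
| "max_time (Assign x e) = 1 + acost e"
| "max_time (Store a i e) = 1 + acost i + acost e"
| "max_time (Seq c1 c2) = max_time c1 + max_time c2"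
| "max_time (If b c1 c2) = 1 + bcost b + max_time c1 + max_time c2"
| "max_time (While b c) = 0"

fun wp :: "int \<Rightarrow> com \<Rightarrow> (state \<Rightarrow> bool) \<Rightarrow> state \<Rightarrow> bool" where
  "wp W Skip Q s \<longleftrightarrow> Q s"
| "wp W (Assign x e) Q s \<longleftrightarrow> asafe W e s \<and> Q (s\<lparr>reg := (reg s)(x := aval e s)\<rparr>)"
| "wp W (Store a i e) Q s \<longleftrightarrow> asafe W i s \<and> 0 \<le> aval i s \<and> asafe W e s \<and>
     Q (s\<lparr>arr := (arr s)(a := (arr s a)(nat (aval i s) := aval e s))\<rparr>)"
| "wp W (Seq c1 c2) Q s \<longleftrightarrow> wp W c1 (wp W c2 Q) s"
| "wp W (If b c1 c2) Q s \<longleftrightarrow>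
     bsafe W b s \<and> (bval b s \<longrightarrow> wp W c1 Q s) \<and> (\<not> bval b s \<longrightarrow> wp W c2 Q s)"
| "wp W (While b c) Q s \<longleftrightarrow> False"

definition terminates_within :: "int \<Rightarrow> com \<Rightarrow> state \<Rightarrow> nat \<Rightarrow> (state \<Rightarrow> bool) \<Rightarrow> bool" where
  "terminates_within W c s T Q \<longleftrightarrow> (\<exists>t s'. exec W c s t s' \<and> t \<le> T \<and> Q s')"

lemma terminates_within_weaken:
  assumes "terminates_within W c s T Q" "T \<le> T'" "\<And>s'. Q s' \<Longrightarrow> Q' s'"
  shows "terminates_within W c s T' Q'"
  using assms unfolding terminates_within_def by (meson le_trans)

lemma terminates_within_Seq:
  assumes "terminates_within W c1 s T1 R" "\<And>s'. R s' \<Longrightarrow> terminates_within W c2 s' T2 Q"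
  shows "terminates_within W (Seq c1 c2) s (T1 + T2) Q"
  using assms unfolding terminates_within_def by (meson add_mono exec.Seq)

lemma terminates_within_wp: "wp W c Q s \<Longrightarrow> terminates_within W c s (max_time c) Q"
proof (induction c arbitrary: Q s)
  case (Seq c1 c2)
  have "terminates_within W c1 s (max_time c1) (wp W c2 Q)"
    using Seq by simp
  then show ?case
    using Seq.IH(2) by (auto intro: terminates_within_Seq)
next
  case (If b c1 c2)
  show ?case
  proof (cases "bval b s")
    case True
    then obtain t s' where "exec W c1 s t s'" "t \<le> max_time c1" "Q s'"
      using If unfolding terminates_within_def by fastforce
    moreover have "bsafe W b s"
      using If.prems by simp
    ultimately show ?thesis
      using exec.IfTrue[OF _ True, of W c1 t s' c2] unfolding terminates_within_def
      by (intro exI[of _ "1 + bcost b + t"] exI[of _ s']) auto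
  next
    case False
    then obtain t s' where "exec W c2 s t s'" "t \<le> max_time c2" "Q s'"
      using If unfolding terminates_within_def by fastforce
    moreover have "bsafe W b s"
      using If.prems by simp
    ultimately show ?thesis
      using exec.IfFalse[OF _ False, of W c2 t s' c1] unfolding terminates_within_def
      by (intro exI[of _ "1 + bcost b + t"] exI[of _ s']) auto
  qed
qed (fastforce simp: terminates_within_def intro: exec.intros)+

definition iteration_time :: "bexp \<Rightarrow> com \<Rightarrow> nat" where
  "iteration_time b c = 1 + bcost b + max_time c"

text \<open>The invariant carries a measure that drops in each iteration and so bounds their number;
  the \<open>+ 1\<close> pays for the final failing test. The body must be loop-free for
  \<open>wp\<close> to apply.\<close>

lemma terminates_within_While:
  assumes safe: "\<And>m s. I m s \<Longrightarrow> bsafe W b s"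
    and body: "\<And>m s. I m s \<Longrightarrow> bval b s \<Longrightarrow> wp W c (\<lambda>s'. \<exists>m'<m. I m' s') s"
    and init: "I m s"
  shows "terminates_within W (While b c) s (iteration_time b c * (m + 1))
    (\<lambda>s'. \<not> bval b s' \<and> (\<exists>m'. I m' s'))"
  using init
proof (induction m arbitrary: s rule: less_induct)
  case (less m)
  note bs = safe[OF less.prems]
  show ?case
  proof (cases "bval b s")
    case False
    then show ?thesis
      using exec.WhileFalse[OF bs False, of c] less.prems
      unfolding terminates_within_def iteration_time_def by fastforce
  next
    case True
    obtain t1 s1 m1 where 1: "exec W c s t1 s1" "t1 \<le> max_time c" "m1 < m" "I m1 s1"
      using terminates_within_wp[OF body[OF less.prems True]]
      unfolding terminates_within_def by blast
    obtain t2 s2 m2 where 2: "exec W (While b c) s1 t2 s2"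
      "t2 \<le> iteration_time b c * (m1 + 1)" "\<not> bval b s2" "I m2 s2"
      using less.IH[OF 1(3,4)] unfolding terminates_within_def by blast
    have "iteration_time b c * (m1 + 1) \<le> iteration_time b c * m"
      using 1(3) by (intro mult_left_mono) auto
    then have "1 + bcost b + t1 + t2 \<le> iteration_time b c * (m + 1)"
      using 1(2) 2(2) by (simp add: iteration_time_def algebra_simps)
    then show ?thesis
      using exec.WhileTrue[OF bs True 1(1) 2(1)] 2(3,4) unfolding terminates_within_def by blast
  qed
qed

section \<open>The input\<close>

lemma concat_nth_offset:
  assumes "v < length xss" "q < length (xss ! v)"
  shows "length (concat (take v xss)) + q < length (concat xss)"
    "concat xss ! (length (concat (take v xss)) + q) = xss ! v ! q"
proof -
  have *: "concat xss = concat (take v xss) @ xss ! v @ concat (drop (Suc v) xss)"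
    by (metis assms(1) concat.simps(2) concat_append id_take_nth_drop)
  show "length (concat (take v xss)) + q < length (concat xss)"
    using assms(2) by (subst * ) simp
  show "concat xss ! (length (concat (take v xss)) + q) = xss ! v ! q"
    using assms(2) by (subst * ) (simp add: nth_append)
qed

lemma length_concat_take_Suc:
  "v < length xss \<Longrightarrow>
    length (concat (take (Suc v) xss)) = length (concat (take v xss)) + length (xss ! v)"
  by (simp add: take_Suc_conv_app_nth)

lemma length_concat_take_le: "length (concat (take v xss)) \<le> length (concat xss)"
  by (metis append_take_drop_id concat_append le_add1 length_append)

text \<open>Handshake bound: a vertex with one of its neighbours is an orientation of an edge, and
  an edge has at most two orientations.\<close>

lemma sum_neighbours_le:
  assumes G: "is_graph G"
  shows "(\<Sum>v\<in>verts G. card {u. {u, v} \<in> edges G}) \<le> 2 * card (edges G)"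
proof -
  have fin: "finite (verts G)"
    using G by (simp add: is_graph_def)
  have finN: "finite {u. {u, v} \<in> edges G}" for v
    using fin by (rule rev_finite_subset) (auto dest: edge_verts[OF G])
  have "(\<Sum>v\<in>verts G. card {u. {u, v} \<in> edges G}) = card (SIGMA v:verts G. {u. {u, v} \<in> edges G})"
    using fin finN by (intro card_SigmaI[symmetric]) auto
  also have "\<dots> \<le> card (\<Union>e\<in>edges G. {(v, u). e = {u, v}})"
  proof (rule card_mono)
    show "finite (\<Union>e\<in>edges G. {(v, u). e = {u, v}})"
    proof (rule finite_subset)
      show "(\<Union>e\<in>edges G. {(v, u). e = {u, v}}) \<subseteq> verts G \<times> verts G"
        using edge_verts[OF G] by auto
    qed (use fin in simp)
  qed auto
  also have "\<dots> \<le> (\<Sum>e\<in>edges G. card {(v, u). e = {u, v}})"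
    by (rule card_UN_le[OF finite_edges[OF G]])
  also have "\<dots> \<le> (\<Sum>e\<in>edges G. 2)"
  proof (rule sum_mono)
    fix e assume "e \<in> edges G"
    then obtain a b where "e = {a, b}"
      using edgeE[OF G] by metis
    then have "{(v, u). e = {u, v}} \<subseteq> {(a, b), (b, a)}"
      by (auto simp: doubleton_eq_iff)
    then have "card {(v, u). e = {u, v}} \<le> card {(a, b), (b, a)}"
      by (intro card_mono) auto
    also have "\<dots> \<le> 2"
      by (intro card_insert_le_m1) auto
    finally show "card {(v, u). e = {u, v}} \<le> 2" .
  qed
  finally show ?thesis
    by simp
qed

text \<open>The quadratic term of the word bound is for the sums of deltas: up to \<open>n\<close>
  children, each contributing at most \<open>n + 1\<close>. The linear terms leave room for array
  positions, at most \<open>2 * n\<close>, and for intermediate results.\<close>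

locale tree_input =
  fixes G :: "nat graph" and adj :: "nat list list" and k W :: int
  assumes tree: "is_tree G" and adj: "adjacency_lists G adj"
    and W: "int (length adj) * int (length adj) + 4 * int (length adj) + 4 + \<bar>k\<bar> \<le> W"
begin

abbreviation "n \<equiv> length adj"

lemma graph: "is_graph G" and acyc: "acyclic_graph G" and conn: "connected_graph G"
  using tree by (auto simp: is_tree_def)

lemma verts: "verts G = {..<n}"
  using adj by (simp add: adjacency_lists_def)

lemma set_adj: "v < n \<Longrightarrow> set (adj ! v) = {u. {u, v} \<in> edges G}"
  and distinct_adj: "v < n \<Longrightarrow> distinct (adj ! v)"
  using adj by (auto simp: adjacency_lists_def)

lemma adj_less: "v < n \<Longrightarrow> u \<in> set (adj ! v) \<Longrightarrow> u < n"
  using edge_verts(1)[OF graph] set_adj verts by fastforce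

lemma n_pos: "0 < n"
  using conn verts by (auto simp: connected_graph_def)

lemma sum_degrees: "(\<Sum>v<n. length (adj ! v)) \<le> 2 * n"
proof -
  have "(\<Sum>v<n. length (adj ! v)) = (\<Sum>v\<in>verts G. card {u. {u, v} \<in> edges G})"
    unfolding verts by (intro sum.cong refl) (metis distinct_adj distinct_card lessThan_iff set_adj)
  also have "\<dots> \<le> 2 * card (edges G)"
    by (rule sum_neighbours_le[OF graph])
  also have "\<dots> \<le> 2 * n"
    using forest_card_edges[OF graph acyc] n_pos verts by (simp add: lessThan_empty_iff)
  finally show ?thesis .
qed

lemma length_concat_adj: "length (concat adj) \<le> 2 * n"
  using sum_degrees by (simp add: length_concat sum_list_sum_nth atLeast0LessThan)

abbreviation offset :: "nat \<Rightarrow> nat" where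
  "offset v \<equiv> length (concat (take v adj))"

lemma offset_le: "offset v \<le> 2 * n"
  using length_concat_take_le[of v adj] length_concat_adj by linarith

definition input :: "state \<Rightarrow> bool" where
  "input s \<longleftrightarrow> reg s ''n'' = int n \<and> reg s ''k'' = k \<and>
     (\<forall>v\<le>n. arr s ''start'' v = int (offset v)) \<and>
     (\<forall>i<length (concat adj). arr s ''nbr'' i = int (concat adj ! i))"

section \<open>Breadth-first search\<close>

text \<open>
  The list \<open>os\<close> contains the discovered vertices in order of discovery; the first \<open>h\<close> of them
  are processed, and \<open>q\<close> neighbours of the next one. The parent of the root is the non-vertex \<open>n\<close>.
\<close>

definition search :: "nat list \<Rightarrow> (nat \<Rightarrow> nat) \<Rightarrow> nat \<Rightarrow> nat \<Rightarrow> bool" where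
  "search os p h q \<longleftrightarrow> distinct os \<and> set os \<subseteq> {..<n} \<and> os \<noteq> [] \<and> os ! 0 = 0 \<and> p 0 = n \<and>
     h \<le> length os \<and>
     (\<forall>i<length os. 0 < i \<longrightarrow> (\<exists>j<i. p (os ! i) = os ! j) \<and> {os ! i, p (os ! i)} \<in> edges G) \<and>
     (\<forall>i<h. set (adj ! (os ! i)) \<subseteq> set os) \<and>
     (h < length os \<longrightarrow> q \<le> length (adj ! (os ! h)) \<and> set (take q (adj ! (os ! h))) \<subseteq> set os)"

text \<open>Termination measure: an unprocessed vertex accounts for one step per neighbour and one
  step to move past it; \<open>q\<close> steps at the current vertex are done.\<close>

definition remaining :: "nat list \<Rightarrow> nat \<Rightarrow> nat \<Rightarrow> nat" where
  "remaining os h q = (\<Sum>v\<in>{..<n} - set (take h os). length (adj ! v) + 1) - q"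

lemma search_init: "search [0] (\<lambda>v. if v = 0 then n else 0) 0 0"
  using n_pos by (simp add: search_def)

lemma search_old:
  assumes "search os p h q" "h < length os" "q < length (adj ! (os ! h))"
    "adj ! (os ! h) ! q \<in> set os"
  shows "search os p h (Suc q)"
  using assms by (auto simp: search_def take_Suc_conv_app_nth)

lemma search_new:
  assumes s: "search os p h q" and h: "h < length os" and q: "q < length (adj ! (os ! h))"
    and u: "u = adj ! (os ! h) ! q" "u \<notin> set os"
  shows "search (os @ [u]) (p(u := os ! h)) h (Suc q)"
proof -
  have hn: "os ! h < n"
    using s h nth_mem by (fastforce simp: search_def)
  have uin: "u \<in> set (adj ! (os ! h))"
    using u q by simp
  have "u < n" and edge: "{u, os ! h} \<in> edges G"
    using adj_less[OF hn uin] uin set_adj[OF hn] by auto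
  have "os \<noteq> []" "os ! 0 = 0"
    using s by (simp_all add: search_def)
  then have "u \<noteq> 0"
    using u(2) by (metis length_greater_0_conv nth_mem)
  have "(\<exists>j<i. (p(u := os ! h)) ((os @ [u]) ! i) = (os @ [u]) ! j) \<and>
      {(os @ [u]) ! i, (p(u := os ! h)) ((os @ [u]) ! i)} \<in> edges G"
    if i: "i < length (os @ [u])" "0 < i" for i
  proof (cases "i = length os")
    case True
    then show ?thesis
      using h edge by (auto simp: nth_append intro!: exI[of _ h])
  next
    case False
    then have "i < length os"
      using i by simp
    then have "os ! i \<noteq> u"
      using u(2) nth_mem by metis
    moreover obtain j where "j < i" "p (os ! i) = os ! j" "{os ! i, p (os ! i)} \<in> edges G"
      using s \<open>i < length os\<close> i(2) by (auto simp: search_def)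
    ultimately show ?thesis
      using \<open>i < length os\<close> by (auto simp: nth_append intro!: exI[of _ j])
  qed
  moreover have "\<forall>i<h. set (adj ! ((os @ [u]) ! i)) \<subseteq> set (os @ [u])"
    using s h by (auto simp: search_def nth_append)
  moreover have "set (take (Suc q) (adj ! (os ! h))) \<subseteq> set (os @ [u])"
    using s h q u by (auto simp: search_def take_Suc_conv_app_nth)
  ultimately show ?thesis
    using s h q u \<open>u < n\<close> \<open>u \<noteq> 0\<close> unfolding search_def by (simp add: nth_append)
qed

lemma search_next:
  assumes s: "search os p h q" and h: "h < length os" and q: "length (adj ! (os ! h)) \<le> q"
  shows "search os p (Suc h) 0"
  using assms by (auto simp: search_def less_Suc_eq)

lemma remaining_bound:
  assumes s: "search os p h q" and h: "h < length os"
  shows "(\<Sum>v\<in>{..<n} - set (take h os). length (adj ! v) + 1) =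
    (\<Sum>v\<in>{..<n} - set (take (Suc h) os). length (adj ! v) + 1) + (length (adj ! (os ! h)) + 1)"
proof -
  have "os ! h < n"
    using s h nth_mem by (fastforce simp: search_def)
  moreover have "os ! h \<notin> set (take h os)"
    using s h by (auto simp: search_def in_set_conv_nth nth_eq_iff_index_eq)
  ultimately have "{..<n} - set (take h os) = insert (os ! h) ({..<n} - set (take (Suc h) os))"
    using h by (auto simp: take_Suc_conv_app_nth)
  moreover have "os ! h \<notin> {..<n} - set (take (Suc h) os)"
    using h by (auto simp: take_Suc_conv_app_nth)
  ultimately show ?thesis
    by simp
qed

lemma remaining_Suc:
  assumes "search os p h q" "h < length os" "q < length (adj ! (os ! h))"
  shows "remaining os h (Suc q) < remaining os h q"
  using remaining_bound[OF assms(1,2)] assms(3) by (simp add: remaining_def)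

lemma remaining_next:
  assumes "search os p h q" "h < length os"
  shows "remaining os (Suc h) 0 < remaining os h q"
proof -
  have "q \<le> length (adj ! (os ! h))"
    using assms by (simp add: search_def)
  then show ?thesis
    unfolding remaining_def remaining_bound[OF assms] by linarith
qed

lemma remaining_append: "h < length os \<Longrightarrow> remaining (os @ [u]) h q = remaining os h q"
  by (simp add: remaining_def)

lemma remaining_init: "remaining [0] 0 0 \<le> 3 * n"
  using sum_degrees by (simp add: remaining_def sum_Suc)

end

text \<open>
  A topological order of the tree, in which parents precede their children, as found by a
  completed search.
\<close>

locale ordered_tree = tree_input +
  fixes os :: "nat list" and p :: "nat \<Rightarrow> nat"
  assumes distinct: "distinct os" and set_os: "set os = {..<n}"
    and parent: "\<And>i. i < n \<Longrightarrow> p (os ! i) = n \<or> (\<exists>j<i. p (os ! i) = os ! j)"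
    and edge_iff: "\<And>u v. u < n \<Longrightarrow> v < n \<Longrightarrow> {u, v} \<in> edges G \<longleftrightarrow> p u = v \<or> p v = u"

context tree_input
begin

text \<open>Connectivity makes every vertex discovered. The edges from the vertices other than 0 to
  their parents are distinct because parents are discovered earlier. There are \<open>n - 1\<close>
  of them and a forest has no more, so every edge joins a child to its parent.\<close>

lemma search_complete:
  assumes s: "search os p (length os) q"
  shows "ordered_tree G adj k W os p"
proof -
  have dist: "distinct os" and sub: "set os \<subseteq> {..<n}" and ne: "os \<noteq> []" and "os ! 0 = 0"
    and p0: "p 0 = n" and closed: "\<And>i. i < length os \<Longrightarrow> set (adj ! (os ! i)) \<subseteq> set os"
    and par: "\<And>i. i < length os \<Longrightarrow> 0 < i \<Longrightarrow>
      (\<exists>j<i. p (os ! i) = os ! j) \<and> {os ! i, p (os ! i)} \<in> edges G"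
    using s by (auto simp: search_def)
  have zero: "0 \<in> set os"
    using ne \<open>os ! 0 = 0\<close> by (metis length_greater_0_conv nth_mem)
  have reach: "v \<in> set os" if "(0, v) \<in> {(x, y). {x, y} \<in> edges G}\<^sup>*" for v
    using that
  proof (induction rule: rtrancl_induct)
    case base
    show ?case by (rule zero)
  next
    case (step y z)
    then obtain i where i: "i < length os" "os ! i = y"
      by (auto simp: in_set_conv_nth)
    have "y < n"
      using step.IH sub by auto
    then have "z \<in> set (adj ! y)"
      using step.hyps(2) set_adj by (auto simp: insert_commute)
    then show ?case
      using closed[OF i(1)] i(2) by auto
  qed
  have set_os: "set os = {..<n}"
    using sub reach conn n_pos verts by (auto simp: connected_graph_def)
  then have len: "length os = n"
    using distinct_card[OF dist] by simp
  have pos: "0 < i" if "i < n" "os ! i \<noteq> 0" for i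
    using that \<open>os ! 0 = 0\<close> by (metis gr0I)
  define f where "f v = {v, p v}" for v
  have f_edge: "f v \<in> edges G" if v: "v \<in> {..<n} - {0}" for v
  proof -
    obtain i where "i < n" "os ! i = v"
      using v set_os len by (metis DiffD1 in_set_conv_nth)
    then show ?thesis
      using par[of i] pos[of i] v len by (auto simp: f_def)
  qed
  have no2: False if uv: "p u = v" "p v = u" "u < n" "v < n" for u v
  proof -
    obtain i j where ij: "i < n" "os ! i = u" "j < n" "os ! j = v"
      using uv(3,4) set_os len by (metis in_set_conv_nth lessThan_iff)
    have "u \<noteq> 0" "v \<noteq> 0"
      using p0 uv by (metis less_irrefl)+
    then obtain i' j' where "i' < i" "p u = os ! i'" "j' < j" "p v = os ! j'"
      using par[of i] par[of j] pos[of i] pos[of j] ij len by auto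
    moreover have "os ! i' = os ! j" "os ! j' = os ! i"
      using uv ij calculation by simp_all
    ultimately have "i' = j" "j' = i"
      using ij len nth_eq_iff_index_eq[OF dist] by (metis less_trans)+
    then show False
      using \<open>i' < i\<close> \<open>j' < j\<close> by simp
  qed
  have "inj_on f ({..<n} - {0})"
    unfolding inj_on_def f_def doubleton_eq_iff by (metis DiffD1 lessThan_iff no2)
  then have "card (f ` ({..<n} - {0})) = n - 1"
    using n_pos by (simp add: card_image)
  moreover have "card (edges G) \<le> n - 1"
    using forest_card_edges[OF graph acyc] n_pos verts by (simp add: lessThan_empty_iff)
  ultimately have edges: "f ` ({..<n} - {0}) = edges G"
    by (intro card_seteq finite_edges[OF graph] image_subsetI f_edge) auto
  show ?thesis
  proof
    show "distinct os" "set os = {..<n}"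
      by fact+
    show "p (os ! i) = n \<or> (\<exists>j<i. p (os ! i) = os ! j)" if "i < n" for i
      using par[of i] that len p0 \<open>os ! 0 = 0\<close> by (cases "i = 0") auto
    show "{u, v} \<in> edges G \<longleftrightarrow> p u = v \<or> p v = u" if "u < n" "v < n" for u v
    proof
      assume "{u, v} \<in> edges G"
      then show "p u = v \<or> p v = u"
        unfolding edges[symmetric] by (auto simp: f_def doubleton_eq_iff)
    next
      have *: "{x, p x} \<in> edges G" if "x < n" "p x < n" for x
        using f_edge[of x] p0 that by (cases "x = 0") (auto simp: f_def)
      assume "p u = v \<or> p v = u"
      then show "{u, v} \<in> edges G"
        using *[of u] *[of v] that by (auto simp: insert_commute)
    qed
  qed
qed

end

section \<open>The search as a program\<close>

lemma wp_mono: "wp W c Q s \<Longrightarrow> (\<And>s. Q s \<Longrightarrow> Q' s) \<Longrightarrow> wp W c Q' s"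
proof (induction c arbitrary: Q Q' s)
  case (Seq c1 c2)
  have "wp W c1 (wp W c2 Q) s"
    using Seq.prems(1) by simp
  then have "wp W c1 (wp W c2 Q') s"
    by (rule Seq.IH(1)) (rule Seq.IH(2)[OF _ Seq.prems(2)])
  then show ?case
    by simp
next
  case (If b c1 c2)
  show ?case
    using If.prems(1) by (auto intro: If.IH(1)[OF _ If.prems(2)] If.IH(2)[OF _ If.prems(2)])
qed simp_all

definition bfs_cond :: bexp where
  "bfs_cond = Less (Var ''head'') (Var ''tail'')"

text \<open>Scanning a neighbour and advancing to the next vertex are two branches of one loop,
  which keeps the body loop-free. The register \<open>j\<close> is a position in the concatenated
  adjacency lists.\<close>

definition bfs_body :: com where
  "bfs_body =
     If (Less (Var ''j'') (Elem ''start'' (Add (Elem ''order'' (Var ''head'')) (Num 1))))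
       (Seq (Assign ''u'' (Elem ''nbr'' (Var ''j'')))
       (Seq (If (Eq (Elem ''vis'' (Var ''u'')) (Num 0))
              (Seq (Store ''vis'' (Var ''u'') (Num 1))
              (Seq (Store ''par'' (Var ''u'') (Elem ''order'' (Var ''head'')))
              (Seq (Store ''order'' (Var ''tail'') (Var ''u''))
                   (Assign ''tail'' (Add (Var ''tail'') (Num 1))))))
              Skip)
            (Assign ''j'' (Add (Var ''j'') (Num 1)))))
       (Seq (Assign ''head'' (Add (Var ''head'') (Num 1)))
            (Assign ''j'' (Elem ''start'' (Elem ''order'' (Var ''head'')))))"

text \<open>The root is vertex 0. As memory starts at 0, \<open>order\<close>, \<open>head\<close>
  and \<open>j\<close> already describe the queue \<open>[0]\<close> with nothing scanned.\<close>

definition init_search :: com where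
  "init_search =
     Seq (Store ''par'' (Num 0) (Var ''n''))
     (Seq (Store ''vis'' (Num 0) (Num 1))
          (Assign ''tail'' (Num 1)))"

text \<open>Frame condition: the memory of the later passes, which the search leaves
  untouched.\<close>

definition blank :: "state \<Rightarrow> bool" where
  "blank s \<longleftrightarrow> arr s ''T'' = (\<lambda>_. 0) \<and> arr s ''D'' = (\<lambda>_. 0) \<and> arr s ''I'' = (\<lambda>_. 0) \<and>
     arr s ''S'' = (\<lambda>_. 0) \<and> reg s ''cnt'' = 0 \<and> reg s ''found'' = 0"

context tree_input
begin

lemma W_linear: "4 * int n + 4 \<le> W"
  using W zero_le_square[of "int n"] by linarith

text \<open>Past the end of the queue \<open>order\<close> is fixed to 0, because the body still
  reads \<open>start[order[head]]\<close> when \<open>head\<close> reaches \<open>tail\<close>. The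
  value of \<open>j\<close> is then meaningless, hence its guard.\<close>

definition search_state :: "nat list \<Rightarrow> (nat \<Rightarrow> nat) \<Rightarrow> nat \<Rightarrow> nat \<Rightarrow> state \<Rightarrow> bool" where
  "search_state os p h q s \<longleftrightarrow> input s \<and> blank s \<and>
     reg s ''head'' = int h \<and> reg s ''tail'' = int (length os) \<and>
     arr s ''order'' = (\<lambda>i. if i < length os then int (os ! i) else 0) \<and>
     arr s ''vis'' = (\<lambda>v. if v \<in> set os then 1 else 0) \<and>
     arr s ''par'' = (\<lambda>v. int (p v)) \<and>
     (h < length os \<longrightarrow> reg s ''j'' = int (offset (os ! h) + q))"

lemma search_length: "search os p h q \<Longrightarrow> length os \<le> n"
  unfolding search_def by (metis card_lessThan card_mono distinct_card finite_lessThan)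

lemma bfs_body:
  assumes se: "search os p h q" and st: "search_state os p h q s" and h: "h < length os"
  shows "wp W bfs_body (\<lambda>s'. \<exists>os' p' h' q'. remaining os' h' q' < remaining os h q \<and>
    search os' p' h' q' \<and> search_state os' p' h' q' s') s"
proof -
  have sub: "set os \<subseteq> {..<n}" and q: "q \<le> length (adj ! (os ! h))" and len: "length os \<le> n"
    using se h search_length[OF se] by (auto simp: search_def)
  have os_n: "os ! i < n" if "i < length os" for i
    using that sub nth_mem by blast
  define v where "v = os ! h"
  have v: "v < n"
    unfolding v_def by (rule os_n[OF h])
  note off = length_concat_take_Suc[OF v]
  have bounds: "offset v + length (adj ! v) \<le> 2 * n" "offset v \<le> 2 * n"
    using offset_le[of "Suc v"] offset_le[of v] off by simp_all
  have nat_Suc: "nat (int v + 1) = Suc v"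
    by simp
  have start: "arr s ''start'' (Suc v) = int (offset v) + int (length (adj ! v))"
      "\<And>u. u \<le> n \<Longrightarrow> arr s ''start'' u = int (offset u)"
    using st v off by (auto simp: search_state_def input_def)
  have regs: "reg s ''head'' = int h" "reg s ''tail'' = int (length os)"
      "reg s ''j'' = int (offset v) + int q"
    and arrs: "arr s ''order'' = (\<lambda>i. if i < length os then int (os ! i) else 0)"
     "arr s ''vis'' = (\<lambda>v. if v \<in> set os then 1 else 0)" "arr s ''par'' = (\<lambda>v. int (p v))"
    and inp: "input s" and bl: "blank s"
    using st h by (auto simp: search_state_def v_def)
  show ?thesis
  proof (cases "q < length (adj ! v)")
    case True
    define u where "u = adj ! v ! q"
    have u: "u < n"
      unfolding u_def using adj_less[OF v] True by simp
    have nbr: "arr s ''nbr'' (offset v + q) = int u"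
      using inp concat_nth_offset[OF v True] by (simp add: input_def u_def)
    have nat_j: "nat (int (offset v) + int q) = offset v + q"
      by simp
    show ?thesis
    proof (cases "u \<in> set os")
      case old: True
      have "wp W bfs_body (search_state os p h (Suc q)) s"
        unfolding bfs_body_def search_state_def
        using inp bl True v u h len bounds W_linear
        by (simp add: regs arrs v_def[symmetric] nat_Suc start nat_j nbr old input_def blank_def)
      then show ?thesis
        using search_old[OF se h] remaining_Suc[OF se h] True old
        by (elim wp_mono) (metis u_def v_def)
    next
      case new: False
      have *: "(\<lambda>i. if i < length os then int (os ! i) else 0)(length os := int u) =
          (\<lambda>i. if i < length (os @ [u]) then int ((os @ [u]) ! i) else 0)"
        by (auto simp: fun_eq_iff nth_append)
      have **: "(\<lambda>v. if v \<in> set os then 1 else 0 :: int)(u := 1) =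
          (\<lambda>v. if v \<in> set (os @ [u]) then 1 else 0)"
        by (auto simp: fun_eq_iff)
      have ***: "(\<lambda>w. int (p w))(u := int v) = (\<lambda>w. int ((p(u := v)) w))"
        by (auto simp: fun_eq_iff)
      have "wp W bfs_body (search_state (os @ [u]) (p(u := v)) h (Suc q)) s"
        unfolding bfs_body_def search_state_def * [symmetric] **[symmetric] ***[symmetric]
        using inp bl True v u h len bounds W_linear
        by (simp add: regs arrs v_def[symmetric] nat_Suc start nat_j nbr new input_def blank_def
            nth_append)
      then show ?thesis
        using search_new[OF se h _ _ new] remaining_Suc[OF se h] remaining_append[OF h] True
        by (elim wp_mono) (metis u_def v_def)
    qed
  next
    case False
    then have q_eq: "q = length (adj ! v)"
      using q by (simp add: v_def)
    have start_next: "arr s ''start'' (os ! Suc h) = int (offset (os ! Suc h))" if "Suc h < length os"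
      using start(2)[of "os ! Suc h"] os_n[OF that] by simp
    have next_W: "int (os ! Suc h) < W" if "Suc h < length os"
      using os_n[OF that] W_linear by linarith
    have "wp W bfs_body (search_state os p (Suc h) 0) s"
      unfolding bfs_body_def search_state_def
      using inp bl v h len bounds W_linear offset_le[of "os ! Suc h"]
      by (simp add: regs arrs v_def[symmetric] nat_Suc start input_def blank_def
          nat_add_distrib q_eq start_next next_W)
    then show ?thesis
      using search_next[OF se h] remaining_next[OF se h] False
      by (elim wp_mono) (metis not_less v_def)
  qed
qed

lemma bfs_loop:
  assumes "search_state [0] (\<lambda>v. if v = 0 then n else 0) 0 0 s"
  shows "terminates_within W (While bfs_cond bfs_body) s (iteration_time bfs_cond bfs_body * (3 * n + 1))
    (\<lambda>s'. \<exists>os p q. search os p (length os) q \<and> search_state os p (length os) q s')"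
proof -
  define Inv where "Inv m s' \<longleftrightarrow> (\<exists>os p h q. m = remaining os h q \<and>
    search os p h q \<and> search_state os p h q s')" for m s'
  have "terminates_within W (While bfs_cond bfs_body) s
      (iteration_time bfs_cond bfs_body * (remaining [0] 0 0 + 1))
      (\<lambda>s'. \<not> bval bfs_cond s' \<and> (\<exists>m. Inv m s'))"
  proof (rule terminates_within_While)
    show "Inv (remaining [0] 0 0) s"
      using search_init assms unfolding Inv_def by blast
    fix m s' assume I: "Inv m s'"
    then obtain os p h q where *: "m = remaining os h q" "search os p h q" "search_state os p h q s'"
      by (auto simp: Inv_def)
    then have hn: "h \<le> length os" "length os \<le> n"
      using search_length by (auto simp: search_def)
    then show "bsafe W bfs_cond s'"
      using * W_linear by (simp add: bfs_cond_def search_state_def)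
    assume "bval bfs_cond s'"
    then have "h < length os"
      using * by (simp add: bfs_cond_def search_state_def)
    from bfs_body[OF *(2,3) this] show "wp W bfs_body (\<lambda>s'. \<exists>m'<m. Inv m' s') s'"
      by (rule wp_mono) (use * Inv_def in blast)
  qed
  then show ?thesis
  proof (rule terminates_within_weaken)
    show "iteration_time bfs_cond bfs_body * (remaining [0] 0 0 + 1)
        \<le> iteration_time bfs_cond bfs_body * (3 * n + 1)"
      using remaining_init by (intro mult_left_mono) auto
    fix s' assume "\<not> bval bfs_cond s' \<and> (\<exists>m. Inv m s')"
    then obtain os p h q where *: "search os p h q" "search_state os p h q s'"
      and "\<not> bval bfs_cond s'"
      by (auto simp: Inv_def)
    then have "h = length os"
      by (simp add: bfs_cond_def search_state_def search_def)
    then show "\<exists>os p q. search os p (length os) q \<and> search_state os p (length os) q s'"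
      using * by blast
  qed
qed

lemma init_search:
  "wp W init_search (search_state [0] (\<lambda>v. if v = 0 then n else 0) 0 0) (init_state adj k)"
proof -
  have "(\<lambda>_. 0 :: int)(0 := int n) = (\<lambda>v. int (if v = 0 then n else 0))"
    "(\<lambda>_. 0 :: int)(0 := 1) = (\<lambda>v. if v = 0 then 1 else 0)"
    by auto
  then show ?thesis
    using W_linear n_pos
    by (simp add: init_search_def search_state_def init_state_def input_def blank_def fun_eq_iff)
qed

end

section \<open>The two passes over the tree\<close>

definition compute_cap :: com where
  "compute_cap =
     If (Less (Elem ''T'' (Var ''v'')) (Num 2)) (Assign ''c'' (Num 1)) (Assign ''c'' (Num 0))"

definition up_cond :: bexp where
  "up_cond = Less (Num 0) (Var ''i'')"

text \<open>The test \<open>c < D[v]\<close> is the negation of \<open>flag\<close>, so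
  \<open>g\<close> becomes the gain. The root needs no test: its contributions go to the index
  \<open>n\<close>, which belongs to no vertex.\<close>

definition up_body :: com where
  "up_body =
     Seq (Assign ''i'' (Sub (Var ''i'') (Num 1)))
     (Seq (Assign ''v'' (Elem ''order'' (Var ''i'')))
     (Seq (Assign ''p'' (Elem ''par'' (Var ''v'')))
     (Seq compute_cap
     (Seq (If (Less (Var ''c'') (Elem ''D'' (Var ''v'')))
            (Assign ''g'' (Var ''c''))
            (Seq (Assign ''g'' (Elem ''D'' (Var ''v'')))
                 (Store ''T'' (Var ''p'') (Add (Elem ''T'' (Var ''p'')) (Num 1)))))
          (If (Eq (Elem ''T'' (Var ''v'')) (Num 0))
            (Store ''D'' (Var ''p'') (Add (Sub (Elem ''D'' (Var ''p'')) (Var ''g'')) (Num 1)))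
            (Store ''D'' (Var ''p'') (Sub (Elem ''D'' (Var ''p'')) (Var ''g''))))))))"

definition down_cond :: bexp where
  "down_cond = Less (Var ''i'') (Var ''n'')"

definition delete_v :: com where
  "delete_v =
     Seq (Store ''S'' (Var ''v'') (Num 1)) (Assign ''cnt'' (Add (Var ''cnt'') (Num 1)))"

text \<open>For the root, \<open>I\<close> is read at index \<open>n\<close>, where it stays 0, so
  the root is treated as having a parent outside \<open>I\<close>.\<close>

definition down_body :: com where
  "down_body =
     Seq (Assign ''v'' (Elem ''order'' (Var ''i'')))
     (Seq (Assign ''i'' (Add (Var ''i'') (Num 1)))
     (Seq compute_cap
       (If (Eq (Elem ''I'' (Elem ''par'' (Var ''v''))) (Num 0))
         (If (Less (Var ''c'') (Elem ''D'' (Var ''v'')))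
           (If (Eq (Var ''c'') (Num 1)) delete_v Skip)
           (Store ''I'' (Var ''v'') (Num 1)))
         (If (Eq (Elem ''T'' (Var ''v'')) (Num 0)) delete_v Skip))))"

definition decide :: com where
  "decide = If (Less (Var ''k'') (Var ''cnt'')) Skip (Assign ''found'' (Num 1))"

context ordered_tree
begin

section \<open>Bottom-up pass\<close>

lemma length_os: "length os = n"
  using distinct_card[OF distinct] set_os by simp

lemma os_less: "i < n \<Longrightarrow> os ! i < n"
  using set_os nth_mem[of i os] length_os by auto

lemma parent_le: "i < n \<Longrightarrow> p (os ! i) \<le> n"
  using parent[of i] os_less by (metis less_imp_le less_trans order_refl)

lemma parent_earlier:
  assumes "j < n" "p (os ! j) = os ! i" "i < n"
  shows "i < j"
proof -
  have "p (os ! j) \<noteq> n"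
    using assms os_less by (metis less_irrefl)
  then obtain l where "l < j" "p (os ! j) = os ! l"
    using parent[OF assms(1)] by auto
  then show ?thesis
    using assms distinct length_os by (auto simp: nth_eq_iff_index_eq)
qed

lemma in_drop:
  assumes "v \<in> set (drop i os)"
  obtains j where "i \<le> j" "j < n" "v = os ! j"
proof -
  obtain m where "m < length (drop i os)" "v = drop i os ! m"
    using assms by (metis in_set_conv_nth)
  then show thesis
    using that[of "i + m"] length_os by simp
qed

lemma in_take:
  assumes "v \<in> set (take i os)"
  obtains j where "j < i" "j < n" "v = os ! j"
proof -
  obtain m where "m < length (take i os)" "v = take i os ! m"
    using assms by (metis in_set_conv_nth)
  then show thesis
    using that[of m] length_os by simp
qed

text \<open>The tables once the vertices from position \<open>i\<close> on are handled. Their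
  entries are final, since children come after parents; therefore \<open>t\<close> and
  \<open>d\<close> may stand on both sides of their equations.\<close>

definition summed :: "nat \<Rightarrow> (nat \<Rightarrow> int) \<Rightarrow> (nat \<Rightarrow> int) \<Rightarrow> bool" where
  "summed i t d \<longleftrightarrow> i \<le> n \<and>
     (\<forall>u. t u = int (card {c \<in> set (drop i os). p c = u \<and> flag (t c) (d c)})) \<and>
     (\<forall>u. d u = (\<Sum>c | c \<in> set (drop i os) \<and> p c = u. delta (t c) (d c)))"

lemma summed_le: "summed i t d \<Longrightarrow> i \<le> n"
  unfolding summed_def by (rule conjunct1)

lemma summed_card:
  assumes "summed i t d"
  shows "int (card {c \<in> set (drop i os). p c = u \<and> flag (t c) (d c)}) = t u"
  by (rule assms[unfolded summed_def, THEN conjunct2, THEN conjunct1, THEN spec, symmetric])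

lemma summed_sum:
  assumes "summed i t d"
  shows "(\<Sum>c | c \<in> set (drop i os) \<and> p c = u. delta (t c) (d c)) = d u"
  by (rule assms[unfolded summed_def, THEN conjunct2, THEN conjunct2, THEN spec, symmetric])

lemma summed_init: "summed n (\<lambda>_. 0) (\<lambda>_. 0)"
  using length_os by (simp add: summed_def)

text \<open>Only the entries at \<open>p v\<close> change, and \<open>p v\<close> is not among the
  vertices from position \<open>i\<close> on, so their flags and deltas stay valid.\<close>

lemma summed_step:
  assumes s: "summed (Suc i) t d"
  defines "v \<equiv> os ! i"
  defines "t' \<equiv> t(p v := t (p v) + (if flag (t v) (d v) then 1 else 0))"
    and "d' \<equiv> d(p v := d (p v) + delta (t v) (d v))"
  shows "summed i t' d'"
proof -
  have i: "i < n"
    using summed_le[OF s] by simp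
  define P where "P = set (drop (Suc i) os)"
  have P: "set (drop i os) = insert v P" "finite P"
    using i length_os by (simp_all add: P_def v_def flip: Cons_nth_drop_Suc)
  have vP: "v \<notin> P"
    unfolding P_def v_def using i distinct length_os
    by (auto simp: nth_eq_iff_index_eq elim!: in_drop)
  have pv: "p v \<notin> insert v P"
  proof
    assume "p v \<in> insert v P"
    then obtain j where "i \<le> j" "j < n" "p v = os ! j"
      unfolding P(1)[symmetric] by (rule in_drop)
    then show False
      using parent_earlier[OF i, of j] v_def by auto
  qed
  have same: "t' c = t c" "d' c = d c" if "c \<in> insert v P" for c
    using pv that by (auto simp: t'_def d'_def)
  have "t' u = int (card {c \<in> insert v P. p c = u \<and> flag (t' c) (d' c)})" for u
  proof -
    have "{c \<in> insert v P. p c = u \<and> flag (t' c) (d' c)} =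
        {c \<in> P. p c = u \<and> flag (t c) (d c)} \<union> (if p v = u \<and> flag (t v) (d v) then {v} else {})"
      using same by auto
    also have "int (card \<dots>) = t u + (if p v = u \<and> flag (t v) (d v) then 1 else 0)"
      using P(2) vP summed_card[OF s, folded P_def] by auto
    also have "\<dots> = t' u"
      by (simp add: t'_def)
    finally show ?thesis ..
  qed
  moreover have "d' u = (\<Sum>c | c \<in> insert v P \<and> p c = u. delta (t' c) (d' c))" for u
  proof -
    have "(\<Sum>c | c \<in> insert v P \<and> p c = u. delta (t' c) (d' c)) =
        (\<Sum>c | c \<in> insert v P \<and> p c = u. delta (t c) (d c))"
      using same by (intro sum.cong) auto
    also have "\<dots> = (if p v = u then delta (t v) (d v) else 0) +
        (\<Sum>c | c \<in> P \<and> p c = u. delta (t c) (d c))"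
    proof -
      have "{c. c \<in> insert v P \<and> p c = u} =
          (if p v = u then insert v {c. c \<in> P \<and> p c = u} else {c. c \<in> P \<and> p c = u})"
        by auto
      then show ?thesis
        using P(2) vP by simp
    qed
    also have "\<dots> = d' u"
      using summed_sum[OF s, folded P_def] by (simp add: d'_def)
    finally show ?thesis ..
  qed
  ultimately show ?thesis
    using less_imp_le[OF i] unfolding summed_def P(1) by blast
qed

text \<open>As \<open>delta\<close> is at least -1, a sum over at most \<open>n\<close> children is
  at least \<open>- n\<close>. This bounds \<open>gain\<close> from below, hence
  \<open>delta\<close> by \<open>n + 1\<close> from above, and the sums by
  \<open>n * (n + 1)\<close>.\<close>

lemma summed_bounds:
  assumes s: "summed i t d"
  shows "0 \<le> t u" "t u \<le> int n" "- int n \<le> d u" "d u \<le> int n * int n + int n"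
proof -
  have card_le: "card {c \<in> set (drop i os). Q c} \<le> n" for Q
    by (metis (no_types, lifting) List.finite_set card_lessThan card_mono finite_lessThan
        mem_Collect_eq set_drop_subset set_os subset_iff)
  show "0 \<le> t u" "t u \<le> int n"
    using card_le[of "\<lambda>c. p c = u \<and> flag (t c) (d c)"] summed_card[OF s, of u] by linarith+
  have lower: "- int n \<le> d u" for u
  proof -
    define C where "C = {c \<in> set (drop i os). p c = u}"
    have "(\<Sum>c\<in>C. - 1) \<le> (\<Sum>c\<in>C. delta (t c) (d c))"
      by (intro sum_mono) (simp add: delta_def gain_def cap_def min_def)
    then show ?thesis
      using summed_sum[OF s, of u] card_le[of "\<lambda>c. p c = u"] by (simp add: C_def)
  qed
  then show "- int n \<le> d u" .
  define C where "C = {c \<in> set (drop i os). p c = u}"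
  have "(\<Sum>c\<in>C. delta (t c) (d c)) \<le> (\<Sum>c\<in>C. int n + 1)"
  proof (rule sum_mono)
    show "delta (t c) (d c) \<le> int n + 1" for c
      using lower[of c] by (auto simp: delta_def gain_def cap_def)
  qed
  also have "\<dots> = int (card C) * (int n + 1)"
    by simp
  also have "\<dots> \<le> int n * (int n + 1)"
    using card_le[of "\<lambda>c. p c = u"] by (intro mult_right_mono) (auto simp: C_def)
  finally show "d u \<le> int n * int n + int n"
    using summed_sum[OF s, of u] by (simp add: C_def algebra_simps)
qed

definition order_state :: "state \<Rightarrow> bool" where
  "order_state s \<longleftrightarrow> reg s ''n'' = int n \<and> reg s ''k'' = k \<and> reg s ''found'' = 0 \<and>
     (\<forall>i<n. arr s ''order'' i = int (os ! i)) \<and> arr s ''par'' = (\<lambda>v. int (p v))"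

definition up_state :: "nat \<Rightarrow> (nat \<Rightarrow> int) \<Rightarrow> (nat \<Rightarrow> int) \<Rightarrow> state \<Rightarrow> bool" where
  "up_state i t d s \<longleftrightarrow> order_state s \<and> reg s ''i'' = int i \<and> arr s ''T'' = t \<and> arr s ''D'' = d \<and>
     arr s ''I'' = (\<lambda>_. 0) \<and> arr s ''S'' = (\<lambda>_. 0) \<and> reg s ''cnt'' = 0"

lemma up_body:
  assumes su: "summed (Suc i) t d" and st: "up_state (Suc i) t d s"
  shows "wp W up_body (\<lambda>s'. \<exists>t' d'. summed i t' d' \<and> up_state i t' d' s') s"
proof -
  define v where "v = os ! i"
  define t' where "t' = t(p v := t (p v) + (if flag (t v) (d v) then 1 else 0))"
  define d' where "d' = d(p v := d (p v) + delta (t v) (d v))"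
  have i: "i < n"
    using summed_le[OF su] by simp
  have v: "v < n" "p v \<le> n"
    using os_less[OF i] parent_le[OF i] by (simp_all add: v_def)
  \<comment> \<open>The body reads \<open>T[v]\<close> again after updating \<open>T[p]\<close>, so
    the two entries must be distinct.\<close>
  have pv: "p v \<noteq> v"
    using parent_earlier[OF i _ i] by (auto simp: v_def)
  note b = summed_bounds[OF su]
  have less_W: "\<bar>x\<bar> < W" if "- 2 * int n - 2 \<le> x" "x \<le> int n * int n + 2 * int n + 2" for x
    using that W W_linear by linarith
  have W1: "1 < W" "0 < W" "2 < W" "int i < W" "int i + 1 < W" "int v < W" "int (p v) < W"
    using W_linear i v n_pos by linarith+
  have WT: "\<bar>t u\<bar> < W" "\<bar>t u + 1\<bar> < W" and WD: "\<bar>d u\<bar> < W"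
    and WD1: "\<bar>d u - 1\<bar> < W" "\<bar>d u - 0\<bar> < W" "\<bar>d u - 1 + 1\<bar> < W" "\<bar>d u - 0 + 1\<bar> < W" for u
    using b[of u] zero_le_square[of "int n"] by (intro less_W; linarith)+
  have W_pos: "t u < W" "d u < W" "- d u < W" for u
    using WT(1)[of u] WD[of u] by linarith+
  \<comment> \<open>\<open>D[v]\<close> itself is subtracted only if \<open>v\<close> is flagged,
    and then it is at most \<open>cap\<close>, hence at most 1.\<close>
  have WD2: "\<bar>d u - d w\<bar> < W" "\<bar>d u - d w + 1\<bar> < W" if "d w \<le> 1" for u w
    using that b[of u] b[of w] zero_le_square[of "int n"] by (intro less_W; linarith)+
  note facts = st[unfolded up_state_def order_state_def]
  have "wp W up_body (up_state i t' d') s"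
    unfolding up_body_def compute_cap_def up_state_def order_state_def
    using facts i pv W1 WT WD WD1 WD2 W_pos
    by (auto simp: v_def[symmetric] t'_def d'_def flag_def cap_def delta_def gain_def
        nat_diff_distrib fun_eq_iff)
  then show ?thesis
    using summed_step[OF su] unfolding t'_def d'_def v_def by (elim wp_mono) blast
qed

end

context ordered_tree
begin

lemma up_loop:
  assumes "up_state n (\<lambda>_. 0) (\<lambda>_. 0) s"
  shows "terminates_within W (While up_cond up_body) s
    (iteration_time up_cond up_body * (n + 1))
    (\<lambda>s'. \<exists>t d. summed 0 t d \<and> up_state 0 t d s')"
proof -
  define Inv where "Inv m s' \<longleftrightarrow> (\<exists>t d. summed m t d \<and> up_state m t d s')" for m s'
  have reg_i: "reg s' ''i'' = int m" "m \<le> n" if "Inv m s'" for m s'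
    using that summed_le by (auto simp: Inv_def up_state_def)
  have "terminates_within W (While up_cond up_body) s
      (iteration_time up_cond up_body * (n + 1))
      (\<lambda>s'. \<not> bval up_cond s' \<and> (\<exists>m. Inv m s'))"
  proof (rule terminates_within_While)
    show "Inv n s"
      using assms summed_init unfolding Inv_def by blast
    fix m s' assume I: "Inv m s'"
    show "bsafe W up_cond s'"
      using reg_i[OF I] W_linear by (simp add: up_cond_def)
    assume "bval up_cond s'"
    then obtain i where m: "m = Suc i"
      using reg_i[OF I] by (cases m) (auto simp: up_cond_def)
    obtain t d where "summed (Suc i) t d" "up_state (Suc i) t d s'"
      using I by (auto simp: Inv_def m)
    from up_body[OF this] show "wp W up_body (\<lambda>s'. \<exists>m'<m. Inv m' s') s'"
      by (rule wp_mono) (auto simp: Inv_def m)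
  qed
  then show ?thesis
  proof (rule terminates_within_weaken)
    fix s' assume s': "\<not> bval up_cond s' \<and> (\<exists>m. Inv m s')"
    then obtain m where I: "Inv m s'"
      by blast
    then have "m = 0"
      using s' reg_i[OF I] by (simp add: up_cond_def)
    then show "\<exists>t d. summed 0 t d \<and> up_state 0 t d s'"
      using I by (simp add: Inv_def)
  qed simp
qed

section \<open>Top-down pass\<close>

definition labelled :: "(nat \<Rightarrow> int) \<Rightarrow> (nat \<Rightarrow> int) \<Rightarrow> nat \<Rightarrow> nat set \<Rightarrow> nat set \<Rightarrow> bool" where
  "labelled t d i I S \<longleftrightarrow> i \<le> n \<and> I \<subseteq> set (take i os) \<and> S \<subseteq> set (take i os) \<and>
     (\<forall>v\<in>set (take i os). (v \<in> I \<longleftrightarrow> p v \<notin> I \<and> flag (t v) (d v)) \<and>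
       (v \<in> S \<longleftrightarrow> (if p v \<in> I then t v = 0 else \<not> flag (t v) (d v) \<and> t v < 2)))"

lemma labelled_init: "labelled t d 0 {} {}"
  by (simp add: labelled_def)

text \<open>Neither \<open>v\<close> nor an earlier vertex has \<open>v\<close> as its parent, so
  adding \<open>v\<close> to \<open>I\<close> leaves the conditions on their parents
  unchanged.\<close>

lemma labelled_step:
  assumes lab: "labelled t d i I S" and i: "i < n"
  defines "v \<equiv> os ! i"
  defines "I' \<equiv> if p v \<notin> I \<and> flag (t v) (d v) then insert v I else I"
    and "S' \<equiv> if (if p v \<in> I then t v = 0 else \<not> flag (t v) (d v) \<and> t v < 2) then insert v S else S"
  shows "labelled t d (Suc i) I' S'"
proof -
  define P where "P = set (take i os)"
  have P: "set (take (Suc i) os) = insert v P"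
    using i length_os by (simp add: P_def v_def take_Suc_conv_app_nth)
  have vP: "v \<notin> P"
    unfolding P_def v_def using i distinct length_os
    by (auto simp: nth_eq_iff_index_eq elim!: in_take)
  have pv: "p u \<noteq> v" if u: "u \<in> insert v P" for u
  proof
    assume "p u = v"
    obtain j where j: "j < Suc i" "j < n" "u = os ! j"
      using u unfolding P[symmetric] by (rule in_take)
    then show False
      using parent_earlier[of j i] i \<open>p u = v\<close> v_def by auto
  qed
  have same: "p u \<in> I' \<longleftrightarrow> p u \<in> I" if "u \<in> insert v P" for u
    using pv[OF that] by (simp add: I'_def)
  have IS: "I \<subseteq> P" "S \<subseteq> P" and old: "\<And>u. u \<in> P \<Longrightarrow> u \<in> I \<longleftrightarrow> p u \<notin> I \<and> flag (t u) (d u)"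
    "\<And>u. u \<in> P \<Longrightarrow> u \<in> S \<longleftrightarrow> (if p u \<in> I then t u = 0 else \<not> flag (t u) (d u) \<and> t u < 2)"
    using lab unfolding labelled_def P_def by blast+
  have I'_iff: "u \<in> I' \<longleftrightarrow> p u \<notin> I' \<and> flag (t u) (d u)" if u: "u \<in> insert v P" for u
  proof (cases "u = v")
    case True
    have "v \<notin> I"
      using IS vP by auto
    then show ?thesis
      using same[OF u] pv[OF u] True by (simp add: I'_def)
  next
    case False
    then show ?thesis
      using old(1)[of u] u unfolding same[OF u] by (auto simp: I'_def)
  qed
  have S'_iff: "u \<in> S' \<longleftrightarrow> (if p u \<in> I' then t u = 0 else \<not> flag (t u) (d u) \<and> t u < 2)"
    if u: "u \<in> insert v P" for u
  proof (cases "u = v")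
    case True
    have "v \<notin> S"
      using IS vP by auto
    then show ?thesis
      using same[OF u] True by (simp add: S'_def)
  next
    case False
    then show ?thesis
      using old(2)[of u] u unfolding same[OF u] by (auto simp: S'_def)
  qed
  have "I' \<subseteq> insert v P" "S' \<subseteq> insert v P"
    using IS by (auto simp: I'_def S'_def)
  then show ?thesis
    using i I'_iff S'_iff unfolding labelled_def P by auto
qed

definition down_state :: "(nat \<Rightarrow> int) \<Rightarrow> (nat \<Rightarrow> int) \<Rightarrow> nat \<Rightarrow> nat set \<Rightarrow> nat set \<Rightarrow> state \<Rightarrow> bool" where
  "down_state t d i I S s \<longleftrightarrow> order_state s \<and> reg s ''i'' = int i \<and>
     arr s ''T'' = t \<and> arr s ''D'' = d \<and>
     arr s ''I'' = (\<lambda>v. if v \<in> I then 1 else 0) \<and> arr s ''S'' = (\<lambda>v. if v \<in> S then 1 else 0) \<and>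
     reg s ''cnt'' = int (card S)"

lemma labelled_card:
  assumes "labelled t d i I S"
  shows "finite S" "card S \<le> n"
proof -
  have "S \<subseteq> {..<n}"
    using assms set_take_subset[of i os] set_os unfolding labelled_def by blast
  then show "finite S" "card S \<le> n"
    using finite_subset card_mono[of "{..<n}" S] by auto
qed

lemma down_body:
  assumes su: "summed 0 t d" and lab: "labelled t d i I S" and i: "i < n"
    and st: "down_state t d i I S s"
  shows "wp W down_body (\<lambda>s'. \<exists>I' S'. labelled t d (Suc i) I' S' \<and> down_state t d (Suc i) I' S' s') s"
proof -
  define v where "v = os ! i"
  define I' where "I' = (if p v \<notin> I \<and> flag (t v) (d v) then insert v I else I)"
  define S' where "S' = (if (if p v \<in> I then t v = 0 else \<not> flag (t v) (d v) \<and> t v < 2)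
    then insert v S else S)"
  have v: "v < n" "p v \<le> n"
    using os_less[OF i] parent_le[OF i] by (simp_all add: v_def)
  have "v \<notin> set (take i os)"
    unfolding v_def using i distinct length_os
    by (auto simp: nth_eq_iff_index_eq elim!: in_take)
  \<comment> \<open>Needed for \<open>cnt\<close>: adding \<open>v\<close> to \<open>S\<close>
    raises the cardinality by exactly one.\<close>
  then have vS: "v \<notin> S"
    using lab unfolding labelled_def by blast
  note cS = labelled_card[OF lab]
  note b = summed_bounds[OF su]
  have W1: "1 < W" "0 < W" "2 < W" "int i < W" "int i + 1 < W" "int v < W" "int (p v) < W"
    "int (card S) < W" "int (card S) + 1 < W"
    using W_linear i v n_pos cS by linarith+
  have WTD: "\<bar>t v\<bar> < W" "\<bar>d v\<bar> < W"
    using b[of v] W W_linear by linarith+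
  note facts = st[unfolded down_state_def order_state_def]
  have "wp W down_body (down_state t d (Suc i) I' S') s"
    unfolding down_body_def compute_cap_def delete_v_def down_state_def order_state_def
    using facts i W1 WTD cS(1) vS
    by (auto simp: v_def[symmetric] I'_def S'_def flag_def cap_def nat_add_distrib fun_eq_iff)
  then show ?thesis
    using labelled_step[OF lab i] unfolding I'_def S'_def v_def by (elim wp_mono) blast
qed

lemma down_loop:
  assumes su: "summed 0 t d" and "down_state t d 0 {} {} s"
  shows "terminates_within W (While down_cond down_body) s
    (iteration_time down_cond down_body * (n + 1))
    (\<lambda>s'. \<exists>I S. labelled t d n I S \<and> down_state t d n I S s')"
proof -
  define Inv where "Inv m s' \<longleftrightarrow>
    (\<exists>i I S. m = n - i \<and> labelled t d i I S \<and> down_state t d i I S s')" for m s'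
  have "terminates_within W (While down_cond down_body) s
      (iteration_time down_cond down_body * (n + 1))
      (\<lambda>s'. \<not> bval down_cond s' \<and> (\<exists>m. Inv m s'))"
  proof (rule terminates_within_While)
    show "Inv n s"
      using assms labelled_init unfolding Inv_def by (metis diff_zero)
    fix m s' assume "Inv m s'"
    then obtain i I S where *: "m = n - i" "labelled t d i I S" "down_state t d i I S s'"
      by (auto simp: Inv_def)
    have regs: "reg s' ''i'' = int i" "reg s' ''n'' = int n" "i \<le> n"
      using *(2,3) by (simp_all add: down_state_def order_state_def labelled_def)
    then show "bsafe W down_cond s'"
      using W_linear by (simp add: down_cond_def)
    assume "bval down_cond s'"
    then have i: "i < n"
      using regs by (simp add: down_cond_def)
    have "n - Suc i < m"
      using i * by simp
    then show "wp W down_body (\<lambda>s'. \<exists>m'<m. Inv m' s') s'"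
      using down_body[OF su *(2) i *(3)] unfolding Inv_def by (elim wp_mono) blast
  qed
  then show ?thesis
  proof (rule terminates_within_weaken)
    fix s' assume s': "\<not> bval down_cond s' \<and> (\<exists>m. Inv m s')"
    then obtain i I S where *: "labelled t d i I S" "down_state t d i I S s'"
      by (auto simp: Inv_def)
    then have "i = n"
      using s' by (simp add: down_cond_def down_state_def order_state_def labelled_def)
    then show "\<exists>I S. labelled t d n I S \<and> down_state t d n I S s'"
      using * by blast
  qed simp
qed

text \<open>The suffix from position 0 and the prefix of length \<open>n\<close> are both the whole
  order, so the partial equations become those of the locale.\<close>

lemma rooted_dp_solution:
  assumes su: "summed 0 t d" and lab: "labelled t d n I S"
  shows "rooted_dp_solution G p t d I S"
proof
  have drop: "set (drop 0 os) = {..<n}" "set (take n os) = {..<n}"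
    using set_os length_os by simp_all
  show "is_graph G" "acyclic_graph G"
    using graph acyc .
  show "{u, v} \<in> edges G \<longleftrightarrow> p u = v \<or> p v = u" if "u \<in> verts G" "v \<in> verts G" for u v
    using edge_iff[of u v] that by (simp add: verts)
  show "p (p v) \<noteq> v" if v: "v \<in> verts G" "p v \<in> verts G" for v
  proof
    assume pp: "p (p v) = v"
    obtain i j where "i < n" "os ! i = v" "j < n" "os ! j = p v"
      using v set_os length_os unfolding verts by (metis in_set_conv_nth)
    then show False
      using parent_earlier[of i j] parent_earlier[of j i] pp by simp
  qed
  show "t v = int (card {c \<in> verts G. p c = v \<and> flag (t c) (d c)})" for v
    using summed_card[OF su, of v] unfolding drop verts by (rule sym)
  show "d v = (\<Sum>c | c \<in> verts G \<and> p c = v. delta (t c) (d c))" for v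
    using summed_sum[OF su, of v] unfolding drop verts by (rule sym)
qed (use lab set_os length_os in \<open>auto simp: labelled_def verts\<close>)

text \<open>\<open>S\<close> has the least possible size, so comparing it with \<open>k\<close>
  settles existence; otherwise \<open>found\<close> keeps its initial 0.\<close>

lemma decide:
  assumes su: "summed 0 t d" and lab: "labelled t d n I S" and st: "down_state t d n I S s"
  shows "wp W decide (correct_output G k) s"
proof -
  interpret rooted_dp_solution G p t d I S
    by (rule rooted_dp_solution[OF su lab])
  have S: "v \<in> S \<Longrightarrow> v \<in> verts G" for v
    using S_sub by auto
  have "card S < W" "\<bar>k\<bar> < W" "1 < W"
    using labelled_card[OF lab] W_linear W zero_le_square[of "int n"] by linarith+
  moreover have "\<nexists>S. mu_vc_solution G k S" if "k < int (card S)"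
    using card_S_le that by fastforce
  moreover have "mu_vc_solution G k S" if "\<not> k < int (card S)"
    using mu_vc_solution_S that by simp
  ultimately show ?thesis
    using st S by (simp add: decide_def correct_output_def down_state_def order_state_def)
qed

end

section \<open>The complete program and its running time\<close>

definition tree_program :: com where
  "tree_program =
     Seq init_search
     (Seq (While bfs_cond bfs_body)
     (Seq (Assign ''i'' (Var ''n''))
     (Seq (While up_cond up_body)
     (Seq (Assign ''i'' (Num 0))
     (Seq (While down_cond down_body)
          decide)))))"

text \<open>\<open>3 * n\<close> bounds the initial measure of the search and \<open>n\<close> is
  that of each pass; every 2 is the cost of resetting the register \<open>i\<close>.\<close>

definition tree_time :: "nat \<Rightarrow> nat" where
  "tree_time n = max_time init_search + (iteration_time bfs_cond bfs_body * (3 * n + 1) +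
     (2 + (iteration_time up_cond up_body * (n + 1) +
     (2 + (iteration_time down_cond down_body * (n + 1) + max_time decide)))))"

context ordered_tree
begin

lemma passes:
  assumes st: "search_state os p (length os) q s"
  shows "terminates_within W
    (Seq (Assign ''i'' (Var ''n''))
    (Seq (While up_cond up_body)
    (Seq (Assign ''i'' (Num 0))
    (Seq (While down_cond down_body) decide)))) s
    (2 + (iteration_time up_cond up_body * (n + 1) +
    (2 + (iteration_time down_cond down_body * (n + 1) + max_time decide))))
    (correct_output G k)"
proof (rule terminates_within_Seq)
  have "wp W (Assign ''i'' (Var ''n'')) (up_state n (\<lambda>_. 0) (\<lambda>_. 0)) s"
    using st length_os W_linear
    by (simp add: search_state_def input_def blank_def up_state_def order_state_def)
  from terminates_within_wp[OF this]
  show "terminates_within W (Assign ''i'' (Var ''n'')) s 2 (up_state n (\<lambda>_. 0) (\<lambda>_. 0))"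
    by (simp add: numeral_2_eq_2)
next
  fix s1 assume s1: "up_state n (\<lambda>_. 0) (\<lambda>_. 0) s1"
  show "terminates_within W
    (Seq (While up_cond up_body) (Seq (Assign ''i'' (Num 0)) (Seq (While down_cond down_body) decide))) s1
    (iteration_time up_cond up_body * (n + 1) +
    (2 + (iteration_time down_cond down_body * (n + 1) + max_time decide)))
    (correct_output G k)"
  proof (rule terminates_within_Seq[OF up_loop[OF s1]])
    fix s2 assume "\<exists>t d. summed 0 t d \<and> up_state 0 t d s2"
    then obtain t d where su: "summed 0 t d" and s2: "up_state 0 t d s2"
      by blast
    have "wp W (Assign ''i'' (Num 0)) (down_state t d 0 {} {}) s2"
      using s2 W_linear by (simp add: up_state_def down_state_def order_state_def)
    from terminates_within_wp[OF this]
    have "terminates_within W (Assign ''i'' (Num 0)) s2 2 (down_state t d 0 {} {})"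
      by (simp add: numeral_2_eq_2)
    then show "terminates_within W (Seq (Assign ''i'' (Num 0)) (Seq (While down_cond down_body) decide)) s2
      (2 + (iteration_time down_cond down_body * (n + 1) + max_time decide))
      (correct_output G k)"
    proof (rule terminates_within_Seq)
      fix s3 assume s3: "down_state t d 0 {} {} s3"
      show "terminates_within W (Seq (While down_cond down_body) decide) s3
        (iteration_time down_cond down_body * (n + 1) + max_time decide)
        (correct_output G k)"
        by (rule terminates_within_Seq[OF down_loop[OF su s3]])
          (blast intro: terminates_within_wp decide[OF su])
    qed
  qed
qed

end

lemma (in tree_input) tree_program:
  "terminates_within W tree_program (init_state adj k) (tree_time n) (correct_output G k)"
  unfolding tree_program_def tree_time_def
proof (rule terminates_within_Seq[OF terminates_within_wp[OF init_search]],
    rule terminates_within_Seq[OF bfs_loop])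
  fix s assume "\<exists>os p q. search os p (length os) q \<and> search_state os p (length os) q s"
  then obtain os p q where se: "search os p (length os) q" and st: "search_state os p (length os) q s"
    by blast
  interpret ordered_tree G adj k W os p
    by (rule search_complete[OF se])
  show "terminates_within W
    (Seq (Assign ''i'' (Var ''n''))
    (Seq (While up_cond up_body)
    (Seq (Assign ''i'' (Num 0))
    (Seq (While down_cond down_body) decide)))) s
    (2 + (iteration_time up_cond up_body * (n + 1) +
    (2 + (iteration_time down_cond down_body * (n + 1) + max_time decide))))
    (correct_output G k)"
    by (rule passes[OF st])
qed

theorem theorem2:
  shows "\<exists>c T. solves_mu_vc_on is_tree c T \<and> (\<lambda>n. real (T n)) \<in> O(\<lambda>n. real n)"
proof (intro exI conjI)
  show "solves_mu_vc_on is_tree tree_program tree_time"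
    unfolding solves_mu_vc_on_def
  \<comment> \<open>Table entries are at most quadratic in \<open>n\<close>, and the square of
    \<open>n + |k| + 2\<close> dominates the bound that \<open>tree_input\<close> asks of
    \<open>W\<close>.\<close>
  proof (rule exI[of _ 2], intro allI impI)
    fix G :: "nat graph" and adj k
    assume tree: "is_tree G" and adj: "adjacency_lists G adj"
    then have card: "card (verts G) = length adj"
      by (simp add: adjacency_lists_def)
    define n where "n = int (length adj)"
    have "0 \<le> n * \<bar>k\<bar>" "0 \<le> \<bar>k\<bar> * \<bar>k\<bar>"
      by (simp_all add: n_def)
    then have "n * n + 4 * n + 4 + \<bar>k\<bar> \<le> (n + \<bar>k\<bar> + 2) ^ 2"
      by (simp add: power2_eq_square algebra_simps)
    then interpret tree_input G adj k "(int (card (verts G)) + \<bar>k\<bar> + 2) ^ 2"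
      using tree adj by unfold_locales (simp_all add: card n_def)
    show "\<exists>t s. exec ((int (card (verts G)) + \<bar>k\<bar> + 2) ^ 2) tree_program (init_state adj k) t s \<and>
        t \<le> tree_time (card (verts G)) \<and> correct_output G k s"
      using tree_program unfolding terminates_within_def card .
  qed
  define a where "a = 3 * iteration_time bfs_cond bfs_body + iteration_time up_cond up_body +
    iteration_time down_cond down_body"
  have linear: "tree_time n = a * n + tree_time 0" for n
    by (simp add: tree_time_def a_def algebra_simps)
  show "(\<lambda>n. real (tree_time n)) \<in> O(\<lambda>n. real n)"
  \<comment> \<open>For positive \<open>n\<close>, the constant term \<open>tree_time 0\<close> is
    absorbed into the slope.\<close>
  proof (rule bigoI[of _ "real (a + tree_time 0)"])
    show "\<forall>\<^sub>F n in at_top. norm (real (tree_time n)) \<le> real (a + tree_time 0) * norm (real n)"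
    proof (rule eventually_at_top_linorderI[of 1])
      fix n :: nat assume "1 \<le> n"
      then have "tree_time n \<le> (a + tree_time 0) * n"
        unfolding linear[of n] by (simp add: algebra_simps)
      then show "norm (real (tree_time n)) \<le> real (a + tree_time 0) * norm (real n)"
        by (simp flip: of_nat_mult of_nat_add)
    qed
  qed
qed

end
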